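(* Let $f_1,\dots,f_m:\mathbb{R}^d\to\mathbb{R}$ be convex and $L$-smooth ($L>0$), i.e. for all $x,y\in\mathbb{R}^d$ and $j\in[m]$, $f_j(y)\ge f_j(x)+\langle\nabla f_j(x),y-x\rangle$ and $\|\nabla f_j(x)-\nabla f_j(y)\|\le L\|x-y\|$. Let $f=\frac1m\sum_{j=1}^m f_j$ be $\mu$-strongly convex ($\mu>0$), i.e. $f(y)\ge f(x)+\langle\nabla f(x),y-x\rangle+\frac{\mu}{2}\|y-x\|^2$ for all $x,y\in\mathbb{R}^d$, and let $x^*$ be the minimizer of $f$. Let $0<\gamma\le\min\left\{\frac{1}{144L},\frac{p}{\mu}\right\}$ and $b\ge\max\left\{1,\frac{c\delta}{\gamma\mu}\right\}$. Then the iterates of BR-LSVRG (defined in the context, with stepsize $\gamma$, batchsize $b$, probability $p\in(0,1]$, starting point $x^0$, and a $(\delta,c)$-agnostic robust aggregator) after $K$ iterations satisfy $$\mathbb{E}\Psi_K\le\left(1-\frac{\gamma\mu}{2}\right)^K\Psi_0,$$ where $\Psi_k=\|x^k-x^*\|^2+\frac{72\gamma^2}{p}\sigma_k^2$ and $\sigma_k^2=\frac{1}{Gm}\sum_{i\in\mathcal{G}}\sum_{j=1}^m\|\nabla f_j(w_i^k)-\nabla f_j(x^* )\|^2$.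
   Context: Notation: $[t]=\{1,\dots,t\}$; $\langle\cdot,\cdot\rangle$ and $\|\cdot\|$ are the Euclidean inner product and norm on $\mathbb{R}^d$; $\mathbb{E}$ is the full expectation. Workers: there are $n$ workers, $[n]=\mathcal{G}\cup\mathcal{B}$ with $\mathcal{G}\cap\mathcal{B}=\varnothing$. Here $\mathcal{G}$ is the set of regular workers and $\mathcal{B}$ the set of Byzantine workers, with $|\mathcal{G}|=G\ge(1-\delta)n$ (equivalently $|\mathcal{B}|\le\delta n$) for some $0\le\delta<1/2$. Byzantine workers are omniscient and may send arbitrary vectors (which may depend on everything sent by other workers and on the aggregation rule). Robust aggregator: let $c>0$. A (possibly randomized) aggregation rule $\mathtt{ARAgg}(x_1,\dots,x_n)\in\mathbb{R}^d$ is a $(\delta,c)$-agnostic robust aggregator if it is computed without knowledge of the variance bound $\rho^2$ below and the following holds. Whenever $x_1,\dots,x_n$ are random vectors in $\mathbb{R}^d$ such that for some subset $\mathcal{G}\subseteq[n]$ with $|\mathcal{G}|=G\ge(1-\delta)n$ (not known to the rule) there is $\rho\ge0$ with $\frac{1}{G(G-1)}\sum_{i,l\in\mathcal{G}}\mathbb{E}\|x_i-x_l\|^2\le\rho^2$, the output $\widehat x=\mathtt{ARAgg}(x_1,\dots,x_n)$ satisfies $\mathbb{E}\|\widehat x-\overline x\|^2\le c\delta\rho^2$, where $\overline x=\frac1G\sum_{i\in\mathcal{G}}x_i$. (The normalization presupposes $G\ge2$.) In the algorithm, this property is used at each iteration conditionally on the past iterations. Algorithm BR-LSVRG: inputs are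 stepsize $\gamma>0$, integer batchsize $b\ge1$, starting point $x^0\in\mathbb{R}^d$, probability $p\in(0,1]$, a $(\delta,c)$-agnostic robust aggregator $\mathtt{ARAgg}$, and number of iterations $K$. Set $w_i^0=x^0$ for all $i\in\mathcal{G}$. For $k=0,1,\dots,K-1$: (1) the server sends $x^k$ to all workers; (2) each $i\in\mathcal{G}$ samples $j_{i,k}^1,\dots,j_{i,k}^b$ from $[m]$ uniformly at random, independently from each other and from other workers (and from the past), and sends to the server $$g_i^k=\frac1b\sum_{t=1}^b\left(\nabla f_{j_{i,k}^t}(x^k)-\nabla f_{j_{i,k}^t}(w_i^k)\right)+\nabla f(w_i^k);$$ (3) each $i\in\mathcal{G}$ sets $w_i^{k+1}=x^k$ with probability $p$ and $w_i^{k+1}=w_i^k$ with probability $1-p$ (probabilities conditional on the past iterations); (4) each $i\in\mathcal{B}$ sends an arbitrary vector $g_i^k$; (5) the server sets $x^{k+1}=x^k-\gamma\,\mathtt{ARAgg}(g_1^k,\dots,g_n^k)$. *)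

theory Defs
  imports "HOL-Probability.Probability"
begin

definition gradient :: "('a::real_inner \<Rightarrow> real) \<Rightarrow> 'a \<Rightarrow> 'a" where
  "gradient h x = (THE D. GDERIV h x :> D)"

definition average :: "nat \<Rightarrow> (nat \<Rightarrow> 'a \<Rightarrow> real) \<Rightarrow> 'a \<Rightarrow> real" where
  "average m f x = (1 / real m) * (\<Sum>j=1..m. f j x)"

text \<open>The two clauses below that only give the differential inequality are meaningful because
  the gradient exists everywhere by smoothness.\<close>

definition smooth :: "real \<Rightarrow> ('a::real_inner \<Rightarrow> real) \<Rightarrow> bool" where
  "smooth L h \<longleftrightarrow> (\<forall>x. h differentiable (at x)) \<and>
     (\<forall>x y. norm (gradient h x - gradient h y) \<le> L * norm (x - y))"

definition convex_differentiable :: "('a::real_inner \<Rightarrow> real) \<Rightarrow> bool" where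
  "convex_differentiable h \<longleftrightarrow> (\<forall>x y. h y \<ge> h x + gradient h x \<bullet> (y - x))"

definition strongly_convex :: "real \<Rightarrow> ('a::real_inner \<Rightarrow> real) \<Rightarrow> bool" where
  "strongly_convex \<mu> h \<longleftrightarrow>
     (\<forall>x y. h y \<ge> h x + gradient h x \<bullet> (y - x) + \<mu> / 2 * (norm (y - x))\<^sup>2)"

text \<open>
  A randomized rule is a function \<open>A s v\<close> of the inputs \<open>v 1, \<dots>, v n\<close> and of internal randomness
  \<open>s\<close>, which has law \<open>S\<close> and is independent of the inputs (a deterministic rule ignores \<open>s\<close>).
  \<open>N\<close> ranges over all joint laws of \<open>n\<close> random vectors, so no sample space has to be fixed.
  Expectations are taken as nonnegative integrals: the premise forces the pairwise second moments
  to be finite, and a conclusion with infinite left-hand side is false. The rule receives neither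
  \<open>\<G>\<close> nor \<open>\<rho>\<close>. The normalization is meaningful for \<open>card \<G> \<ge> 2\<close> only.
\<close>

definition agnostic_robust_aggregator ::
  "nat \<Rightarrow> real \<Rightarrow> real \<Rightarrow> 's measure \<Rightarrow> ('s \<Rightarrow> (nat \<Rightarrow> 'a::euclidean_space) \<Rightarrow> 'a) \<Rightarrow> bool" where
  "agnostic_robust_aggregator n \<delta> c S A \<longleftrightarrow>
     prob_space S \<and>
     (\<lambda>(s, v). A s v) \<in> borel_measurable (S \<Otimes>\<^sub>M PiM {1..n} (\<lambda>_. borel)) \<and>
     (\<forall>N \<G> \<rho>.
        prob_space N \<and> sets N = sets (PiM {1..n} (\<lambda>_. borel :: 'a measure)) \<and>
        \<G> \<subseteq> {1..n} \<and> card \<G> \<ge> 2 \<and> real (card \<G>) \<ge> (1 - \<delta>) * real n \<and> \<rho> \<ge> 0 \<and>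
        ennreal (1 / (real (card \<G>) * (real (card \<G>) - 1))) *
          (\<Sum>i\<in>\<G>. \<Sum>l\<in>\<G>. \<integral>\<^sup>+v. ennreal ((norm (v i - v l))\<^sup>2) \<partial>N) \<le> ennreal (\<rho>\<^sup>2)
        \<longrightarrow>
        (\<integral>\<^sup>+(s, v). ennreal ((norm (A s v - (1 / real (card \<G>)) *\<^sub>R (\<Sum>i\<in>\<G>. v i)))\<^sup>2)
           \<partial>(S \<Otimes>\<^sub>M N)) \<le> ennreal (c * \<delta> * \<rho>\<^sup>2))"

text \<open>
  A run of BR-LSVRG on a sample space \<open>M\<close>; \<open>f 1, \<dots>, f m\<close> are the summands and \<open>\<G> \<subseteq> {1..n}\<close> the
  regular workers. \<open>past k\<close> is the information available before iteration \<open>k\<close>, and \<open>sent k\<close> adds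
  at least the samples and all messages of iteration \<open>k\<close>. Both may contain more, so a Byzantine
  message, which only has to be measurable with respect to \<open>sent k\<close>, may depend on everything sent
  by the others and on further randomness of its own, but not on the internal randomness \<open>U k\<close>
  that the server draws afterwards. \<open>coin i k\<close> is the event that worker \<open>i\<close> updates its reference
  point; only its conditional probability given the past is prescribed.
\<close>

locale br_lsvrg = prob_space M
  for M :: "'o measure" +
  fixes n :: nat and \<G> :: "nat set" and m :: nat and f :: "nat \<Rightarrow> 'a::euclidean_space \<Rightarrow> real"
    and \<gamma> :: real and b :: nat and p :: real and x0 :: 'a
    and S :: "'s measure" and A :: "'s \<Rightarrow> (nat \<Rightarrow> 'a) \<Rightarrow> 'a" and K :: nat
    and past sent :: "nat \<Rightarrow> 'o measure"
    and J :: "nat \<Rightarrow> nat \<Rightarrow> nat \<Rightarrow> 'o \<Rightarrow> nat"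
    and coin :: "nat \<Rightarrow> nat \<Rightarrow> 'o set"
    and U :: "nat \<Rightarrow> 'o \<Rightarrow> 's"
    and x :: "nat \<Rightarrow> 'o \<Rightarrow> 'a"
    and w g :: "nat \<Rightarrow> nat \<Rightarrow> 'o \<Rightarrow> 'a"
  assumes past_subalgebra: "k \<le> K \<Longrightarrow> subalgebra M (past k)"
    and past_sent: "k < K \<Longrightarrow> subalgebra (sent k) (past k)"
    and sent_past: "k < K \<Longrightarrow> subalgebra (past (Suc k)) (sent k)"
    and x_init: "\<omega> \<in> space M \<Longrightarrow> x 0 \<omega> = x0"
    and w_init: "\<omega> \<in> space M \<Longrightarrow> i \<in> \<G> \<Longrightarrow> w i 0 \<omega> = x0"
    and J_measurable:
      "k < K \<Longrightarrow> i \<in> \<G> \<Longrightarrow> t \<in> {1..b} \<Longrightarrow> J i k t \<in> sent k \<rightarrow>\<^sub>M count_space {1..m}"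
    and J_uniform:
      "k < K \<Longrightarrow> i \<in> \<G> \<Longrightarrow> t \<in> {1..b} \<Longrightarrow>
        distr M (count_space {1..m}) (J i k t) = uniform_count_measure {1..m}"
    and J_indep: \<comment> \<open>of each other and, through the index \<open>None\<close>, of the past\<close>
      "k < K \<Longrightarrow>
        indep_sets
          (\<lambda>a. case a of None \<Rightarrow> sets (past k)
                 | Some (i, t) \<Rightarrow> {J i k t -` B \<inter> space M | B. B \<subseteq> {1..m}})
          (insert None (Some ` (\<G> \<times> {1..b})))"
    and g_regular:
      "k < K \<Longrightarrow> i \<in> \<G> \<Longrightarrow> \<omega> \<in> space M \<Longrightarrow>
        g i k \<omega> =
          (1 / real b) *\<^sub>R (\<Sum>t=1..b. gradient (f (J i k t \<omega>)) (x k \<omega>)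
                                     - gradient (f (J i k t \<omega>)) (w i k \<omega>))
          + gradient (average m f) (w i k \<omega>)"
    and g_byzantine:
      "k < K \<Longrightarrow> i \<in> {1..n} - \<G> \<Longrightarrow> g i k \<in> borel_measurable (sent k)"
    and coin_event: "k < K \<Longrightarrow> i \<in> \<G> \<Longrightarrow> coin i k \<in> sets (past (Suc k))"
    and coin_prob:
      "k < K \<Longrightarrow> i \<in> \<G> \<Longrightarrow>
        AE \<omega> in M. real_cond_exp M (past k) (indicator (coin i k)) \<omega> = p"
    and w_step:
      "k < K \<Longrightarrow> i \<in> \<G> \<Longrightarrow> \<omega> \<in> space M \<Longrightarrow>
        w i (Suc k) \<omega> = (if \<omega> \<in> coin i k then x k \<omega> else w i k \<omega>)"
    and U_measurable: "k < K \<Longrightarrow> U k \<in> past (Suc k) \<rightarrow>\<^sub>M S"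
    and U_law: "k < K \<Longrightarrow> distr M S (U k) = S"
    and U_indep:
      "k < K \<Longrightarrow> indep_set (sets (sent k)) {U k -` B \<inter> space M | B. B \<in> sets S}"
    and x_step:
      "k < K \<Longrightarrow> \<omega> \<in> space M \<Longrightarrow>
        x (Suc k) \<omega> = x k \<omega> - \<gamma> *\<^sub>R A (U k \<omega>) (\<lambda>i\<in>{1..n}. g i k \<omega>)"

definition sigma_sq ::
  "nat set \<Rightarrow> nat \<Rightarrow> (nat \<Rightarrow> 'a::real_inner \<Rightarrow> real) \<Rightarrow> 'a \<Rightarrow> (nat \<Rightarrow> 'a) \<Rightarrow> real" where
  "sigma_sq \<G> m f xs v =
     1 / (real (card \<G>) * real m) *
       (\<Sum>i\<in>\<G>. \<Sum>j=1..m. (norm (gradient (f j) (v i) - gradient (f j) xs))\<^sup>2)"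

definition Psi ::
  "nat set \<Rightarrow> nat \<Rightarrow> (nat \<Rightarrow> 'a::real_inner \<Rightarrow> real) \<Rightarrow> real \<Rightarrow> real \<Rightarrow> 'a \<Rightarrow> 'a \<Rightarrow> (nat \<Rightarrow> 'a) \<Rightarrow> real" where
  "Psi \<G> m f \<gamma> p xs y v = (norm (y - xs))\<^sup>2 + 72 * \<gamma>\<^sup>2 / p * sigma_sq \<G> m f xs v"

end

theory Submission
  imports Defs
begin

text \<open>
  One iteration contracts the expected potential by the factor \<open>1 - \<gamma> * \<mu> / 2\<close>, and
  the theorem is the iteration of this bound (\<open>mean_Psi_step\<close>, \<open>mean_Psi_bound\<close>).

  Write the aggregated message as \<open>u + e\<close>, where \<open>u\<close> is the mean of the regular
  messages and \<open>e\<close> the aggregation error. Given the past, every regular message is an unbiased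
  estimate of \<open>\<nabla>f (x k)\<close>, so \<open>\<langle>x k - xs, u\<rangle>\<close> has the same expectation as
  \<open>\<langle>x k - xs, \<nabla>f (x k)\<rangle>\<close>; by strong convexity this gains
  \<open>2 * \<gamma>\<close> times the expected gap \<open>f (x k) - f xs\<close> and a factor
  \<open>1 - \<gamma> * \<mu>\<close> on the squared distance. Half of the gain in the factor is spent, through
  Young's inequality, on the term \<open>\<langle>x k - xs, e\<rangle>\<close>, which leaves
  \<open>4 * \<gamma> / \<mu>\<close> times the mean square of \<open>e\<close> (\<open>inexact_step_sq_le\<close>).

  The noise of a regular message is an average of \<open>b\<close> conditionally uncorrelated centred samples
  (\<open>minibatch_second_moment\<close>). Its variance is therefore \<open>1 / b\<close> times that of a
  single sample, which is at most \<open>4 * L\<close> times the gap plus twice the contribution of the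
  worker to \<open>\<sigma>\<^sup>2\<close> (\<open>message_variance\<close>), because for convex smooth functions
  squared gradient differences are bounded by Bregman divergences
  (\<open>gradient_diff_bregman_bound\<close>). The pairwise distances of regular messages, hence by robustness
  the mean square of \<open>e\<close>, inherit this bound up to constants (\<open>aggregation_error_sq\<close>), and
  \<open>b \<ge> c * \<delta> / (\<gamma> * \<mu>)\<close> is exactly what turns \<open>4 * \<gamma> / \<mu>\<close>
  into a factor of order \<open>\<gamma>\<^sup>2\<close>. Only expectations over the whole run occur in these
  estimates, so the robustness of the aggregator is applied to the unconditional law of the messages.

  In total the squared distance obeys \<open>distance_step\<close>, whose error term is
  \<open>\<gamma>\<^sup>2 * (76 * L * gap + 36 * \<sigma>\<^sup>2)\<close>. The reference points satisfy
  \<open>E \<sigma>\<^sup>2 (k + 1) \<le> (1 - p) * E \<sigma>\<^sup>2 k + 2 * p * L * gap\<close>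
  (\<open>reference_step\<close>), so the weight \<open>72 * \<gamma>\<^sup>2 / p\<close> in the potential absorbs
  \<open>36 * \<gamma>\<^sup>2 * \<sigma>\<^sup>2\<close> with half of the decrease \<open>p\<close>, the other half
  being at least \<open>\<gamma> * \<mu> / 2\<close>. The gap enters with the coefficient
  \<open>220 * \<gamma>\<^sup>2 * L - 2 * \<gamma>\<close>, which is negative for \<open>\<gamma> \<le> 1 / (144 * L)\<close>.

  Byzantine messages may have infinite moments. The square integrability of the iterates, which gives
  the expectations above their meaning, therefore comes from the regular messages and from the finite
  mean square of \<open>e\<close> that robustness guarantees.
\<close>

section \<open>Smooth convex functions and inner product inequalities\<close>

lemma gradient_eqI:
  assumes "GDERIV h x :> D"
  shows "gradient h x = D"
  unfolding gradient_def
proof (rule the_equality)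
  fix D' assume "GDERIV h x :> D'"
  then have "(\<lambda>v. v \<bullet> D') = (\<lambda>v. v \<bullet> D)"
    using assms unfolding gderiv_def by (rule has_derivative_unique)
  then have "\<forall>v. v \<bullet> D' = v \<bullet> D"
    by meson
  then show "D' = D"
    by (simp add: vector_eq_ldot)
qed (rule assms)

text \<open>In a Euclidean space every derivative is represented by the vector of its values on the basis.\<close>

lemma differentiable_GDERIV:
  fixes h :: "'a::euclidean_space \<Rightarrow> real"
  assumes "h differentiable (at x)"
  shows "GDERIV h x :> gradient h x"
proof -
  obtain h' where h': "(h has_derivative h') (at x)"
    using assms unfolding differentiable_def by blast
  then have lin: "linear h'"
    by (rule has_derivative_linear)
  define D where "D = (\<Sum>e\<in>Basis. h' e *\<^sub>R e)"
  have "h' v = v \<bullet> D" for v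
  proof -
    have "h' v = h' (\<Sum>e\<in>Basis. (v \<bullet> e) *\<^sub>R e)"
      by (simp add: euclidean_representation)
    also have "\<dots> = (\<Sum>e\<in>Basis. (v \<bullet> e) * h' e)"
      using lin by (simp add: linear_sum linear_scale)
    also have "\<dots> = v \<bullet> D"
      by (simp add: D_def inner_sum_right mult.commute)
    finally show ?thesis .
  qed
  then have "h' = (\<lambda>v. v \<bullet> D)"
    by blast
  with h' have "GDERIV h x :> D"
    by (simp add: gderiv_def)
  then show ?thesis
    using gradient_eqI by metis
qed

lemma average_GDERIV:
  fixes f :: "nat \<Rightarrow> 'a::euclidean_space \<Rightarrow> real"
  assumes "\<forall>j\<in>{1..m}. f j differentiable (at x)"
  shows "GDERIV (average m f) x :> (1 / real m) *\<^sub>R (\<Sum>j=1..m. gradient (f j) x)"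
proof -
  have "(f j has_derivative (\<lambda>v. v \<bullet> gradient (f j) x)) (at x)" if "j \<in> {1..m}" for j
    using differentiable_GDERIV assms that unfolding gderiv_def by blast
  then have "((\<lambda>y. (1 / real m) * (\<Sum>j=1..m. f j y)) has_derivative
      (\<lambda>v. (1 / real m) * (\<Sum>j=1..m. v \<bullet> gradient (f j) x))) (at x)"
    by (intro has_derivative_mult_right has_derivative_sum)
  moreover have "average m f = (\<lambda>y. (1 / real m) * (\<Sum>j=1..m. f j y))"
    by (simp add: average_def fun_eq_iff)
  ultimately show ?thesis
    by (simp add: gderiv_def inner_sum_right)
qed

lemma gradient_at_minimum:
  fixes h :: "'a::real_inner \<Rightarrow> real"
  assumes "GDERIV h z :> D" and "\<forall>y. h z \<le> h y"
  shows "D = 0"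
proof -
  have "(\<lambda>v. v \<bullet> D) = (\<lambda>v. 0)"
    using assms unfolding gderiv_def
    by (intro has_derivative_local_min[of h "\<lambda>v. v \<bullet> D" z]) auto
  then have "D \<bullet> D = 0"
    by meson
  then show ?thesis by simp
qed

text \<open>Along the segment from \<open>x\<close> to \<open>y\<close> the difference of the two sides is a function of
  \<open>t\<close> whose derivative is nonpositive by Cauchy-Schwarz and the Lipschitz bound on the gradient.\<close>

lemma descent_inequality:
  fixes h :: "'a::euclidean_space \<Rightarrow> real"
  assumes "smooth L h"
  shows "h y \<le> h x + gradient h x \<bullet> (y - x) + L / 2 * (norm (y - x))\<^sup>2"
proof -
  define d where "d = y - x"
  define \<phi> where
    "\<phi> t = h (x + t *\<^sub>R d) - t * (gradient h x \<bullet> d) - L / 2 * t\<^sup>2 * (norm d)\<^sup>2" for t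
  define \<phi>' where
    "\<phi>' t = (gradient h (x + t *\<^sub>R d) - gradient h x) \<bullet> d - L * t * (norm d)\<^sup>2" for t
  have der: "(\<phi> has_real_derivative \<phi>' t) (at t)" for t
  proof -
    have "(h has_derivative (\<lambda>v. v \<bullet> gradient h (x + t *\<^sub>R d))) (at (x + t *\<^sub>R d))"
      using assms differentiable_GDERIV unfolding smooth_def gderiv_def by blast
    then have "((\<lambda>t. h (x + t *\<^sub>R d)) has_derivative
        (\<lambda>s. (s *\<^sub>R d) \<bullet> gradient h (x + t *\<^sub>R d))) (at t)"
      by (rule has_derivative_compose[rotated]) (auto intro!: derivative_eq_intros)
    then have "((\<lambda>t. h (x + t *\<^sub>R d)) has_real_derivative gradient h (x + t *\<^sub>R d) \<bullet> d) (at t)"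
      by (simp add: has_field_derivative_def inner_commute mult_commute_abs)
    then show ?thesis
      unfolding \<phi>_def[abs_def] \<phi>'_def
      by (auto intro!: derivative_eq_intros simp: inner_diff_left)
  qed
  have "\<phi>' t \<le> 0" if "0 \<le> t" for t
  proof -
    have "(gradient h (x + t *\<^sub>R d) - gradient h x) \<bullet> d
        \<le> norm (gradient h (x + t *\<^sub>R d) - gradient h x) * norm d"
      by (rule norm_cauchy_schwarz)
    also have "\<dots> \<le> (L * norm ((x + t *\<^sub>R d) - x)) * norm d"
      using assms unfolding smooth_def by (intro mult_right_mono norm_ge_zero) blast
    also have "\<dots> = L * t * (norm d)\<^sup>2"
      using that by (simp add: power2_eq_square)
    finally show ?thesis by (simp add: \<phi>'_def)
  qed
  then have "\<phi> 1 \<le> \<phi> 0"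
    by (intro DERIV_nonpos_imp_nonincreasing[of 0 1 \<phi>]) (use der in auto)
  then show ?thesis
    by (simp add: \<phi>_def d_def)
qed

text \<open>Compare \<open>h\<close> at the gradient step \<open>y = x - (1 / L) *\<^sub>R u\<close>, with
  \<open>u\<close> the difference of the gradients, in two ways: convexity at \<open>z\<close> bounds it from below
  and the descent inequality at \<open>x\<close> from above. This \<open>y\<close> minimizes the upper bound minus
  the lower one.\<close>

lemma gradient_diff_bregman_bound:
  fixes h :: "'a::euclidean_space \<Rightarrow> real"
  assumes "convex_differentiable h" "smooth L h" "L > 0"
  shows "(norm (gradient h x - gradient h z))\<^sup>2
     \<le> 2 * L * (h x - h z - gradient h z \<bullet> (x - z))"
proof -
  define u where "u = gradient h x - gradient h z"
  define y where "y = x - (1 / L) *\<^sub>R u"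
  have yx: "y - x = - ((1 / L) *\<^sub>R u)"
    by (simp add: y_def)
  have "h z + gradient h z \<bullet> (y - z) \<le> h y"
    using assms(1) unfolding convex_differentiable_def by blast
  moreover have "h y \<le> h x + gradient h x \<bullet> (y - x) + L / 2 * (norm (y - x))\<^sup>2"
    using descent_inequality assms(2) by blast
  moreover have "gradient h z \<bullet> (y - z) = gradient h z \<bullet> (y - x) + gradient h z \<bullet> (x - z)"
    by (simp add: inner_diff_right)
  moreover have "gradient h x \<bullet> (y - x) - gradient h z \<bullet> (y - x) = - (1 / L) * (norm u)\<^sup>2"
    unfolding yx by (simp add: u_def power2_norm_eq_inner inner_diff_left diff_divide_distrib)
  moreover have "L / 2 * (norm (y - x))\<^sup>2 = 1 / (2 * L) * (norm u)\<^sup>2"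
    unfolding yx using \<open>L > 0\<close> by (simp add: power2_eq_square field_simps)
  ultimately have "1 / (2 * L) * (norm u)\<^sup>2 \<le> h x - h z - gradient h z \<bullet> (x - z)"
    by (simp add: field_simps)
  then show ?thesis
    using \<open>L > 0\<close> by (simp add: u_def field_simps)
qed

lemma norm_add_sq_le:
  fixes u v :: "'a::real_inner"
  shows "(norm (u + v))\<^sup>2 \<le> 2 * (norm u)\<^sup>2 + 2 * (norm v)\<^sup>2"
proof -
  have "0 \<le> (norm (u - v))\<^sup>2" by simp
  then show ?thesis
    by (simp add: power2_norm_eq_inner inner_simps inner_commute)
qed

lemma norm_mean_sq_le:
  fixes u :: "'i \<Rightarrow> 'a::real_inner"
  assumes "finite I" "I \<noteq> {}"
  shows "(norm ((1 / real (card I)) *\<^sub>R (\<Sum>i\<in>I. u i)))\<^sup>2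
    \<le> (1 / real (card I)) * (\<Sum>i\<in>I. (norm (u i))\<^sup>2)"
proof -
  have c: "real (card I) > 0" using assms by (simp add: card_gt_0_iff)
  have "(norm (\<Sum>i\<in>I. u i))\<^sup>2 \<le> (\<Sum>i\<in>I. norm (u i))\<^sup>2"
    by (intro power_mono norm_sum) auto
  also have "\<dots> \<le> (\<Sum>i\<in>I. (norm (u i))\<^sup>2) * real (card I)"
    using Cauchy_Schwarz_ineq_sum[of "\<lambda>i. norm (u i)" "\<lambda>i. 1" I] by simp
  finally have "(1 / real (card I))\<^sup>2 * (norm (\<Sum>i\<in>I. u i))\<^sup>2
      \<le> (1 / real (card I))\<^sup>2 * ((\<Sum>i\<in>I. (norm (u i))\<^sup>2) * real (card I))"
    by (rule mult_left_mono) simp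
  then show ?thesis
    using c by (simp add: power_mult_distrib power2_eq_square power_divide)
qed

text \<open>Subtracting the mean removes \<open>card I\<close> times its squared norm, so a variance is at most the second moment.\<close>

lemma mean_centered_sq_le:
  fixes u :: "'i \<Rightarrow> 'a::real_inner"
  assumes "finite I" "I \<noteq> {}" and a: "a = (1 / real (card I)) *\<^sub>R (\<Sum>i\<in>I. u i)"
  shows "(\<Sum>i\<in>I. (norm (u i - a))\<^sup>2) \<le> (\<Sum>i\<in>I. (norm (u i))\<^sup>2)"
proof -
  have c: "real (card I) > 0" using assms by (simp add: card_gt_0_iff)
  have s: "(\<Sum>i\<in>I. u i) = real (card I) *\<^sub>R a" using c a by simp
  have "(\<Sum>i\<in>I. (norm (u i - a))\<^sup>2)
      = (\<Sum>i\<in>I. (norm (u i))\<^sup>2) - 2 * ((\<Sum>i\<in>I. u i) \<bullet> a) + real (card I) * (norm a)\<^sup>2"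
    by (simp add: power2_norm_eq_inner inner_simps inner_commute sum.distrib sum_subtractf
        inner_sum_right sum_distrib_left algebra_simps)
  also have "\<dots> = (\<Sum>i\<in>I. (norm (u i))\<^sup>2) - real (card I) * (norm a)\<^sup>2"
    unfolding s by (simp add: power2_norm_eq_inner)
  finally show ?thesis by simp
qed

text \<open>The error \<open>e\<close> of the direction enters the cross term, where Young's inequality with the
  weight \<open>\<gamma> * \<mu> / 2\<close> on \<open>d\<close> splits it off, and the quadratic term, where
  \<open>\<gamma> * \<mu> \<le> 1\<close> lets it be merged into the same multiple of \<open>\<gamma> / \<mu>\<close>.\<close>

lemma inexact_step_sq_le:
  fixes d u e :: "'a::real_inner" and \<gamma> \<mu> :: real
  assumes "0 < \<gamma>" "0 < \<mu>" "\<gamma> * \<mu> \<le> 1"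
  shows "(norm (d - \<gamma> *\<^sub>R (u + e)))\<^sup>2 \<le> (1 + \<gamma> * \<mu> / 2) * (norm d)\<^sup>2 - 2 * \<gamma> * (d \<bullet> u)
    + 2 * \<gamma>\<^sup>2 * (norm u)\<^sup>2 + 4 * \<gamma> / \<mu> * (norm e)\<^sup>2"
proof -
  have "(norm (d - \<gamma> *\<^sub>R v))\<^sup>2 = (norm d)\<^sup>2 - 2 * \<gamma> * (d \<bullet> v) + \<gamma>\<^sup>2 * (norm v)\<^sup>2" for v
    unfolding power2_norm_eq_inner
    by (simp add: inner_diff_left inner_diff_right inner_commute power2_eq_square)
  then have "(norm (d - \<gamma> *\<^sub>R (u + e)))\<^sup>2
      = (norm d)\<^sup>2 - 2 * \<gamma> * (d \<bullet> u) - 2 * \<gamma> * (d \<bullet> e) + \<gamma>\<^sup>2 * (norm (u + e))\<^sup>2"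
    by (simp add: inner_add_right distrib_left)
  moreover have "\<gamma>\<^sup>2 * (norm (u + e))\<^sup>2 \<le> \<gamma>\<^sup>2 * (2 * (norm u)\<^sup>2 + 2 * (norm e)\<^sup>2)"
    by (intro mult_left_mono norm_add_sq_le) auto
  \<comment> \<open>Young's inequality, as nonnegativity of a weighted square.\<close>
  moreover have "- 2 * \<gamma> * (d \<bullet> e) \<le> \<gamma> * \<mu> / 2 * (norm d)\<^sup>2 + 2 * \<gamma> / \<mu> * (norm e)\<^sup>2"
  proof -
    have "0 \<le> \<gamma> * \<mu> / 2 * (norm (d + (2 / \<mu>) *\<^sub>R e))\<^sup>2"
      using assms by simp
    also have "\<dots> = \<gamma> * \<mu> / 2 * (norm d)\<^sup>2 + 2 * \<gamma> * (d \<bullet> e) + 2 * \<gamma> / \<mu> * (norm e)\<^sup>2"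
      using assms by (simp add: power2_norm_eq_inner inner_simps inner_commute field_simps)
    finally show ?thesis by simp
  qed
  moreover have "2 * \<gamma>\<^sup>2 * (norm e)\<^sup>2 \<le> 2 * \<gamma> / \<mu> * (norm e)\<^sup>2"
  proof (rule mult_right_mono)
    have "\<gamma> * (\<gamma> * \<mu>) \<le> \<gamma> * 1"
      using assms by (intro mult_left_mono) auto
    then show "2 * \<gamma>\<^sup>2 \<le> 2 * \<gamma> / \<mu>"
      using assms by (simp add: field_simps power2_eq_square)
  qed simp
  ultimately show ?thesis
    by (simp add: algebra_simps)
qed


section \<open>Square-integrable random vectors\<close>

definition square_integrable :: "'o measure \<Rightarrow> ('o \<Rightarrow> 'a::euclidean_space) \<Rightarrow> bool" where
  "square_integrable M X \<longleftrightarrow> X \<in> borel_measurable M \<and> integrable M (\<lambda>\<omega>. (norm (X \<omega>))\<^sup>2)"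

lemma square_integrable_measurable:
  "square_integrable M X \<Longrightarrow> X \<in> borel_measurable M"
  by (simp add: square_integrable_def)

lemma square_integrable_norm_sq:
  "square_integrable M X \<Longrightarrow> integrable M (\<lambda>\<omega>. (norm (X \<omega>))\<^sup>2)"
  by (simp add: square_integrable_def)

lemma square_integrable_add:
  assumes "square_integrable M X" "square_integrable M Y"
  shows "square_integrable M (\<lambda>\<omega>. X \<omega> + Y \<omega>)"
  unfolding square_integrable_def
proof
  have [measurable]: "X \<in> borel_measurable M" "Y \<in> borel_measurable M"
    using assms by (auto simp: square_integrable_def)
  show "(\<lambda>\<omega>. X \<omega> + Y \<omega>) \<in> borel_measurable M" by measurable
  show "integrable M (\<lambda>\<omega>. (norm (X \<omega> + Y \<omega>))\<^sup>2)"
  proof (rule Bochner_Integration.integrable_bound)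
    show "integrable M (\<lambda>\<omega>. 2 * (norm (X \<omega>))\<^sup>2 + 2 * (norm (Y \<omega>))\<^sup>2)"
      using assms by (auto simp: square_integrable_def)
  qed (auto simp: norm_add_sq_le)
qed

lemma square_integrable_scaleR:
  "square_integrable M X \<Longrightarrow> square_integrable M (\<lambda>\<omega>. r *\<^sub>R X \<omega>)"
  by (auto simp: square_integrable_def power_mult_distrib)

lemma square_integrable_diff:
  assumes "square_integrable M X" "square_integrable M Y"
  shows "square_integrable M (\<lambda>\<omega>. X \<omega> - Y \<omega>)"
  using square_integrable_add[OF assms(1) square_integrable_scaleR[OF assms(2), of "-1"]] by simp

lemma square_integrable_sum:
  assumes "\<And>i. i \<in> I \<Longrightarrow> square_integrable M (X i)"
  shows "square_integrable M (\<lambda>\<omega>. \<Sum>i\<in>I. X i \<omega>)"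
proof (cases "finite I")
  case True
  then show ?thesis
    using assms
    by (induction I) (auto intro!: square_integrable_add simp: square_integrable_def[of M "\<lambda>_. 0"])
qed (simp add: square_integrable_def)

lemma square_integrable_dominated:
  fixes X :: "'o \<Rightarrow> 'a::euclidean_space" and Y :: "'o \<Rightarrow> 'b::euclidean_space"
  assumes "square_integrable M Y" "X \<in> borel_measurable M"
    and "\<And>\<omega>. \<omega> \<in> space M \<Longrightarrow> norm (X \<omega>) \<le> r * norm (Y \<omega>)"
  shows "square_integrable M X"
  unfolding square_integrable_def
proof
  show "integrable M (\<lambda>\<omega>. (norm (X \<omega>))\<^sup>2)"
  proof (rule Bochner_Integration.integrable_bound)
    show "integrable M (\<lambda>\<omega>. r\<^sup>2 * (norm (Y \<omega>))\<^sup>2)"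
      using assms by (auto simp: square_integrable_def)
    show "(\<lambda>\<omega>. (norm (X \<omega>))\<^sup>2) \<in> borel_measurable M"
      using assms(2) by measurable
    show "AE \<omega> in M. norm ((norm (X \<omega>))\<^sup>2) \<le> norm (r\<^sup>2 * (norm (Y \<omega>))\<^sup>2)"
      using power_mono[OF assms(3) norm_ge_zero, of _ 2] by (auto simp: power_mult_distrib)
  qed
qed (rule assms)

text \<open>By polarization.\<close>

lemma integrable_inner:
  assumes "square_integrable M X" "square_integrable M Y"
  shows "integrable M (\<lambda>\<omega>. X \<omega> \<bullet> Y \<omega>)"
proof -
  have "X \<omega> \<bullet> Y \<omega> = ((norm (X \<omega> + Y \<omega>))\<^sup>2 - (norm (X \<omega>))\<^sup>2 - (norm (Y \<omega>))\<^sup>2) / 2" for \<omega>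
    by (simp add: power2_norm_eq_inner inner_simps inner_commute)
  moreover have "integrable M
      (\<lambda>\<omega>. ((norm (X \<omega> + Y \<omega>))\<^sup>2 - (norm (X \<omega>))\<^sup>2 - (norm (Y \<omega>))\<^sup>2) / 2)"
    using assms square_integrable_add[OF assms] by (simp add: square_integrable_def)
  ultimately show ?thesis by presburger
qed

lemma square_integrable_cong_space:
  assumes "\<And>\<omega>. \<omega> \<in> space M \<Longrightarrow> X \<omega> = Y \<omega>"
  shows "square_integrable M X \<longleftrightarrow> square_integrable M Y"
  unfolding square_integrable_def
  using assms by (intro conj_cong measurable_cong Bochner_Integration.integrable_cong) auto

section \<open>Uniform sampling of past-measurable quantities\<close>

context prob_space
begin

lemma square_integrable_const: "square_integrable M (\<lambda>_. a)"
  by (simp add: square_integrable_def)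

text \<open>The conditional probability of \<open>E\<close> given \<open>F\<close> is the constant \<open>q\<close>, expressed
  through its defining identity on the sets of \<open>F\<close>. Both the sampling, which is
  independent of the past, and the coins, whose conditional probability is prescribed, have this form.\<close>

definition constant_cond_prob :: "'a measure \<Rightarrow> 'a set \<Rightarrow> real \<Rightarrow> bool" where
  "constant_cond_prob F E q \<longleftrightarrow> E \<in> events \<and> (\<forall>B\<in>sets F. prob (B \<inter> E) = q * prob B)"

text \<open>The conditional expectation of the indicator is almost surely \<open>q\<close>, and it may replace the
  indicator under the integral against any \<open>F\<close>-measurable function.\<close>

lemma expectation_indicator_constant_cond_prob:
  fixes Y :: "'a \<Rightarrow> real"
  assumes sub: "subalgebra M F" and E: "constant_cond_prob F E q"
    and Y: "Y \<in> borel_measurable F" "integrable M Y"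
  shows "integrable M (\<lambda>\<omega>. indicator E \<omega> * Y \<omega>)"
    and "expectation (\<lambda>\<omega>. indicator E \<omega> * Y \<omega>) = q * expectation Y"
proof -
  interpret F: finite_measure_subalgebra M F
    by unfold_locales (rule sub)
  have [measurable]: "E \<in> events"
    using E by (simp add: constant_cond_prob_def)
  \<comment> \<open>The constant \<open>q\<close> has the characteristic property of the conditional probability.\<close>
  have ce: "AE \<omega> in M. real_cond_exp M F (indicator E) \<omega> = q"
  proof (rule F.real_cond_exp_charact)
    fix B assume B: "B \<in> sets F"
    then have [measurable]: "B \<in> events"
      using sub by (auto simp: subalgebra_def)
    have "(\<integral>\<omega>\<in>B. indicat_real E \<omega> \<partial>M) = (\<integral>\<omega>. indicat_real (B \<inter> E) \<omega> \<partial>M)"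
      unfolding set_lebesgue_integral_def by (simp add: indicator_inter_arith)
    also have "\<dots> = q * prob B"
      using E B by (simp add: constant_cond_prob_def)
    also have "\<dots> = (\<integral>\<omega>\<in>B. q \<partial>M)"
      unfolding set_lebesgue_integral_def by simp
    finally show "(\<integral>\<omega>\<in>B. indicat_real E \<omega> \<partial>M) = (\<integral>\<omega>\<in>B. q \<partial>M)" .
  qed (auto simp: emeasure_eq_measure)
  show int: "integrable M (\<lambda>\<omega>. indicator E \<omega> * Y \<omega>)"
    using integrable_mult_indicator[OF \<open>E \<in> events\<close> Y(2)] by simp
  then have int': "integrable M (\<lambda>\<omega>. Y \<omega> * indicator E \<omega>)"
    by (simp add: mult.commute)
  have "expectation (\<lambda>\<omega>. indicator E \<omega> * Y \<omega>) = expectation (\<lambda>\<omega>. Y \<omega> * indicator E \<omega>)"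
    by (simp add: mult.commute)
  also have "\<dots> = expectation (\<lambda>\<omega>. Y \<omega> * real_cond_exp M F (indicator E) \<omega>)"
    using F.real_cond_exp_intg(2)[OF int' Y(1)] by simp
  also have "\<dots> = expectation (\<lambda>\<omega>. Y \<omega> * q)"
    using ce measurable_from_subalg[OF sub Y(1)] by (intro integral_cong_AE) auto
  finally show "expectation (\<lambda>\<omega>. indicator E \<omega> * Y \<omega>) = q * expectation Y"
    by (simp add: mult.commute)
qed

lemma constant_cond_probI_cond_exp:
  assumes sub: "subalgebra M F" and E: "E \<in> events"
    and ce: "AE \<omega> in M. real_cond_exp M F (indicator E) \<omega> = q"
  shows "constant_cond_prob F E q"
  unfolding constant_cond_prob_def
proof (intro conjI ballI E)
  interpret F: finite_measure_subalgebra M F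
    by unfold_locales (rule sub)
  fix B assume B: "B \<in> sets F"
  then have B': "B \<in> events"
    using sub by (auto simp: subalgebra_def)
  have "prob (B \<inter> E) = (\<integral>\<omega>\<in>B. indicat_real E \<omega> \<partial>M)"
    using B' E unfolding set_lebesgue_integral_def by (simp flip: indicator_inter_arith)
  also have "\<dots> = (\<integral>\<omega>\<in>B. real_cond_exp M F (indicator E) \<omega> \<partial>M)"
    using E B by (intro F.real_cond_exp_intA) (auto simp: emeasure_eq_measure)
  also have "\<dots> = (\<integral>\<omega>\<in>B. q \<partial>M)"
    using ce B' unfolding set_lebesgue_integral_def by (intro integral_cong_AE) auto
  also have "\<dots> = q * prob B"
    using B' unfolding set_lebesgue_integral_def by simp
  finally show "prob (B \<inter> E) = q * prob B" .
qed

definition uniform_given :: "'a measure \<Rightarrow> nat \<Rightarrow> ('a \<Rightarrow> nat) \<Rightarrow> bool" where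
  "uniform_given F m I \<longleftrightarrow>
     I \<in> M \<rightarrow>\<^sub>M count_space {1..m} \<and>
     (\<forall>j\<in>{1..m}. constant_cond_prob F {\<omega> \<in> space M. I \<omega> = j} (1 / real m))"

text \<open>Unlike two instances of \<open>uniform_given\<close>, this includes that the two samples are independent of each other given \<open>F\<close>.\<close>

definition uniform_pair_given :: "'a measure \<Rightarrow> nat \<Rightarrow> ('a \<Rightarrow> nat) \<Rightarrow> ('a \<Rightarrow> nat) \<Rightarrow> bool" where
  "uniform_pair_given F m I I' \<longleftrightarrow>
     (\<forall>j\<in>{1..m}. \<forall>l\<in>{1..m}.
        constant_cond_prob F {\<omega> \<in> space M. I \<omega> = j \<and> I' \<omega> = l} (1 / (real m)\<^sup>2))"

lemma uniform_given_range:
  assumes "uniform_given F m I" "\<omega> \<in> space M"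
  shows "I \<omega> \<in> {1..m}"
  using assms measurable_space[of I M "count_space {1..m}" \<omega>] by (simp add: uniform_given_def)

text \<open>Split according to the finitely many values of the sample; each value has conditional probability \<open>1 / m\<close>.\<close>

lemma expectation_sampled:
  fixes h :: "nat \<Rightarrow> 'a \<Rightarrow> real"
  assumes sub: "subalgebra M F" and I: "uniform_given F m I"
    and h: "\<And>j. j \<in> {1..m} \<Longrightarrow> h j \<in> borel_measurable F" "\<And>j. j \<in> {1..m} \<Longrightarrow> integrable M (h j)"
  shows "integrable M (\<lambda>\<omega>. h (I \<omega>) \<omega>)"
    and "expectation (\<lambda>\<omega>. h (I \<omega>) \<omega>) = (1 / real m) * (\<Sum>j=1..m. expectation (h j))"
proof -
  let ?E = "\<lambda>j. {\<omega> \<in> space M. I \<omega> = j}"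
  have split: "h (I \<omega>) \<omega> = (\<Sum>j=1..m. indicator (?E j) \<omega> * h j \<omega>)" if "\<omega> \<in> space M" for \<omega>
  proof -
    have "I \<omega> \<in> {1..m}"
      using uniform_given_range[OF I that] .
    have "(\<Sum>j=1..m. indicator (?E j) \<omega> * h j \<omega>) = (\<Sum>j=1..m. if j = I \<omega> then h j \<omega> else 0)"
      using that by (intro sum.cong) auto
    also have "\<dots> = h (I \<omega>) \<omega>"
      using \<open>I \<omega> \<in> {1..m}\<close> by simp
    finally show ?thesis ..
  qed
  have *: "integrable M (\<lambda>\<omega>. indicator (?E j) \<omega> * h j \<omega>)"
    "expectation (\<lambda>\<omega>. indicator (?E j) \<omega> * h j \<omega>) = 1 / real m * expectation (h j)"
    if j: "j \<in> {1..m}" for j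
  proof -
    have "constant_cond_prob F (?E j) (1 / real m)"
      using I j unfolding uniform_given_def by blast
    note expectation_indicator_constant_cond_prob[OF sub this h(1)[OF j] h(2)[OF j]]
    then show "integrable M (\<lambda>\<omega>. indicator (?E j) \<omega> * h j \<omega>)"
      "expectation (\<lambda>\<omega>. indicator (?E j) \<omega> * h j \<omega>) = 1 / real m * expectation (h j)" .
  qed
  have "integrable M (\<lambda>\<omega>. \<Sum>j=1..m. indicator (?E j) \<omega> * h j \<omega>)"
    by (rule Bochner_Integration.integrable_sum) (rule *(1))
  then show "integrable M (\<lambda>\<omega>. h (I \<omega>) \<omega>)"
    by (rule Bochner_Integration.integrable_cong[THEN iffD2, OF refl, rotated]) (rule split)
  have "expectation (\<lambda>\<omega>. h (I \<omega>) \<omega>) = expectation (\<lambda>\<omega>. \<Sum>j=1..m. indicator (?E j) \<omega> * h j \<omega>)"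
    by (intro Bochner_Integration.integral_cong refl split)
  also have "\<dots> = (\<Sum>j=1..m. 1 / real m * expectation (h j))"
    using * by (subst Bochner_Integration.integral_sum) auto
  finally show "expectation (\<lambda>\<omega>. h (I \<omega>) \<omega>) = (1 / real m) * (\<Sum>j=1..m. expectation (h j))"
    by (simp add: sum_distrib_left)
qed

lemma square_integrable_sampled:
  fixes h :: "nat \<Rightarrow> 'a \<Rightarrow> 'b::euclidean_space"
  assumes sub: "subalgebra M F" and I: "uniform_given F m I"
    and h: "\<And>j. j \<in> {1..m} \<Longrightarrow> h j \<in> borel_measurable F"
      "\<And>j. j \<in> {1..m} \<Longrightarrow> square_integrable M (h j)"
  shows "square_integrable M (\<lambda>\<omega>. h (I \<omega>) \<omega>)"
  unfolding square_integrable_def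
proof
  have "(\<lambda>\<omega>. \<Sum>j=1..m. indicator {\<omega> \<in> space M. I \<omega> = j} \<omega> *\<^sub>R h j \<omega>) \<in> borel_measurable M"
  proof (intro borel_measurable_sum borel_measurable_scaleR borel_measurable_indicator)
    fix j assume j: "j \<in> {1..m}"
    show "{\<omega> \<in> space M. I \<omega> = j} \<in> events"
      using I j unfolding uniform_given_def constant_cond_prob_def by blast
    show "h j \<in> borel_measurable M"
      using h(2)[OF j] by (rule square_integrable_measurable)
  qed
  moreover have "h (I \<omega>) \<omega> = (\<Sum>j=1..m. indicator {\<omega> \<in> space M. I \<omega> = j} \<omega> *\<^sub>R h j \<omega>)"
    if "\<omega> \<in> space M" for \<omega>
  proof -
    have "I \<omega> \<in> {1..m}"
      using uniform_given_range[OF I that] .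
    have "(\<Sum>j=1..m. indicator {\<omega> \<in> space M. I \<omega> = j} \<omega> *\<^sub>R h j \<omega>)
        = (\<Sum>j=1..m. if j = I \<omega> then h j \<omega> else 0)"
      using that by (intro sum.cong) auto
    also have "\<dots> = h (I \<omega>) \<omega>"
      using \<open>I \<omega> \<in> {1..m}\<close> by simp
    finally show ?thesis ..
  qed
  ultimately show "(\<lambda>\<omega>. h (I \<omega>) \<omega>) \<in> borel_measurable M"
    by (subst measurable_cong) auto
  show "integrable M (\<lambda>\<omega>. (norm (h (I \<omega>) \<omega>))\<^sup>2)"
    by (rule expectation_sampled(1)[OF sub I, where h = "\<lambda>j \<omega>. (norm (h j \<omega>))\<^sup>2"])
      (use h in \<open>auto simp: square_integrable_def\<close>)
qed

text \<open>Given the past, the expected inner product is \<open>1 / m\<^sup>2\<close> times the sum of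
  \<open>\<langle>h j, h l\<rangle>\<close> over all pairs, diagonal included, and that sum is the inner product of
  two vanishing sums.\<close>

lemma expectation_sampled_pair_centered:
  fixes h :: "nat \<Rightarrow> 'a \<Rightarrow> 'b::euclidean_space"
  assumes sub: "subalgebra M F"
    and I: "uniform_given F m I" "uniform_given F m I'" "uniform_pair_given F m I I'"
    and h: "\<And>j. j \<in> {1..m} \<Longrightarrow> h j \<in> borel_measurable F"
      "\<And>j. j \<in> {1..m} \<Longrightarrow> square_integrable M (h j)"
    and centered: "\<And>\<omega>. \<omega> \<in> space M \<Longrightarrow> (\<Sum>j=1..m. h j \<omega>) = 0"
  shows "expectation (\<lambda>\<omega>. h (I \<omega>) \<omega> \<bullet> h (I' \<omega>) \<omega>) = 0"
proof -
  let ?E = "\<lambda>j l. {\<omega> \<in> space M. I \<omega> = j \<and> I' \<omega> = l}"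
  let ?P = "{1..m} \<times> {1..m}"
  have split: "h (I \<omega>) \<omega> \<bullet> h (I' \<omega>) \<omega>
      = (\<Sum>(j, l)\<in>?P. indicator (?E j l) \<omega> * (h j \<omega> \<bullet> h l \<omega>))" if "\<omega> \<in> space M" for \<omega>
  proof -
    have "(\<Sum>(j, l)\<in>?P. indicator (?E j l) \<omega> * (h j \<omega> \<bullet> h l \<omega>))
        = (\<Sum>z\<in>?P. if z = (I \<omega>, I' \<omega>) then h (fst z) \<omega> \<bullet> h (snd z) \<omega> else 0)"
      using that by (intro sum.cong) (auto simp: indicator_def)
    also have "\<dots> = h (I \<omega>) \<omega> \<bullet> h (I' \<omega>) \<omega>"
      using uniform_given_range[OF I(1) that] uniform_given_range[OF I(2) that] by (subst sum.delta) auto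
    finally show ?thesis ..
  qed
  have int: "integrable M (\<lambda>\<omega>. h j \<omega> \<bullet> h l \<omega>)" if "j \<in> {1..m}" "l \<in> {1..m}" for j l
    by (intro integrable_inner h(2) that)
  have *: "integrable M (\<lambda>\<omega>. indicator (?E j l) \<omega> * (h j \<omega> \<bullet> h l \<omega>))"
    "expectation (\<lambda>\<omega>. indicator (?E j l) \<omega> * (h j \<omega> \<bullet> h l \<omega>))
       = 1 / (real m)\<^sup>2 * expectation (\<lambda>\<omega>. h j \<omega> \<bullet> h l \<omega>)"
    if jl: "j \<in> {1..m}" "l \<in> {1..m}" for j l
  proof -
    have "constant_cond_prob F (?E j l) (1 / (real m)\<^sup>2)"
      using I(3) jl unfolding uniform_pair_given_def by blast
    note expectation_indicator_constant_cond_prob[OF sub this borel_measurable_inner[OF h(1)[OF jl(1)] h(1)[OF jl(2)]]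
        int[OF jl]]
    then show "integrable M (\<lambda>\<omega>. indicator (?E j l) \<omega> * (h j \<omega> \<bullet> h l \<omega>))"
      "expectation (\<lambda>\<omega>. indicator (?E j l) \<omega> * (h j \<omega> \<bullet> h l \<omega>))
       = 1 / (real m)\<^sup>2 * expectation (\<lambda>\<omega>. h j \<omega> \<bullet> h l \<omega>)" .
  qed
  have "expectation (\<lambda>\<omega>. h (I \<omega>) \<omega> \<bullet> h (I' \<omega>) \<omega>)
      = expectation (\<lambda>\<omega>. \<Sum>z\<in>?P. indicator (?E (fst z) (snd z)) \<omega> * (h (fst z) \<omega> \<bullet> h (snd z) \<omega>))"
    using split by (intro Bochner_Integration.integral_cong refl) (auto simp: case_prod_beta)
  also have "\<dots> = (\<Sum>z\<in>?P. expectation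
      (\<lambda>\<omega>. indicator (?E (fst z) (snd z)) \<omega> * (h (fst z) \<omega> \<bullet> h (snd z) \<omega>)))"
    by (rule Bochner_Integration.integral_sum) (intro *(1); auto)
  also have "\<dots> = (\<Sum>z\<in>?P. 1 / (real m)\<^sup>2 * expectation (\<lambda>\<omega>. h (fst z) \<omega> \<bullet> h (snd z) \<omega>))"
    by (intro sum.cong refl *(2)) auto
  also have "\<dots> = 1 / (real m)\<^sup>2 * expectation (\<lambda>\<omega>. \<Sum>z\<in>?P. h (fst z) \<omega> \<bullet> h (snd z) \<omega>)"
    using int by (subst Bochner_Integration.integral_sum) (auto simp: sum_distrib_left)
  also have "expectation (\<lambda>\<omega>. \<Sum>z\<in>?P. h (fst z) \<omega> \<bullet> h (snd z) \<omega>) = expectation (\<lambda>_. 0)"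
  proof (intro Bochner_Integration.integral_cong refl)
    fix \<omega> assume \<omega>: "\<omega> \<in> space M"
    have "(\<Sum>z\<in>?P. h (fst z) \<omega> \<bullet> h (snd z) \<omega>) = (\<Sum>j=1..m. h j \<omega>) \<bullet> (\<Sum>l=1..m. h l \<omega>)"
      unfolding inner_sum_right inner_sum_left
      by (subst sum.swap) (simp add: sum.cartesian_product case_prod_beta)
    also have "\<dots> = 0"
      using centered[OF \<omega>] by simp
    finally show "(\<Sum>z\<in>?P. h (fst z) \<omega> \<bullet> h (snd z) \<omega>) = 0" .
  qed
  finally show ?thesis by simp
qed

text \<open>Centred samples are unbiased given the past: they are orthogonal to every past-measurable \<open>Y\<close>.\<close>

lemma minibatch_inner:
  fixes d :: "nat \<Rightarrow> 'a \<Rightarrow> 'b::euclidean_space"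
  assumes sub: "subalgebra M F"
    and I: "\<And>t. t \<in> {1..b} \<Longrightarrow> uniform_given F m (I t)"
    and d: "\<And>j. j \<in> {1..m} \<Longrightarrow> d j \<in> borel_measurable F"
      "\<And>j. j \<in> {1..m} \<Longrightarrow> square_integrable M (d j)"
    and Y: "Y \<in> borel_measurable F" "square_integrable M Y"
    and centered: "\<And>\<omega>. \<omega> \<in> space M \<Longrightarrow> (\<Sum>j=1..m. d j \<omega>) = 0"
  shows "expectation (\<lambda>\<omega>. Y \<omega> \<bullet> (\<Sum>t=1..b. d (I t \<omega>) \<omega>)) = 0"
proof -
  have int: "integrable M (\<lambda>\<omega>. Y \<omega> \<bullet> d j \<omega>)" if "j \<in> {1..m}" for j
    by (intro integrable_inner Y d that)
  note samp = expectation_sampled[OF sub I, where h = "\<lambda>j \<omega>. Y \<omega> \<bullet> d j \<omega>",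
      OF _ borel_measurable_inner[OF Y(1) d(1)] int]
  have zero: "(\<Sum>j=1..m. expectation (\<lambda>\<omega>. Y \<omega> \<bullet> d j \<omega>)) = 0"
  proof -
    have "(\<Sum>j=1..m. expectation (\<lambda>\<omega>. Y \<omega> \<bullet> d j \<omega>)) = expectation (\<lambda>\<omega>. \<Sum>j=1..m. Y \<omega> \<bullet> d j \<omega>)"
      using int by (subst Bochner_Integration.integral_sum) auto
    also have "\<dots> = expectation (\<lambda>_. 0)"
      using centered by (intro Bochner_Integration.integral_cong refl) (simp flip: inner_sum_right)
    finally show ?thesis by simp
  qed
  have "expectation (\<lambda>\<omega>. Y \<omega> \<bullet> (\<Sum>t=1..b. d (I t \<omega>) \<omega>))
      = (\<Sum>t=1..b. expectation (\<lambda>\<omega>. Y \<omega> \<bullet> d (I t \<omega>) \<omega>))"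
    using samp(1) by (simp add: inner_sum_right)
  also have "\<dots> = 0"
    using samp(2) zero by (simp add: sum.neutral)
  finally show ?thesis .
qed

text \<open>The cross terms vanish, so the second moment grows like \<open>b\<close> instead of \<open>b\<^sup>2\<close>.\<close>

lemma minibatch_second_moment:
  fixes d :: "nat \<Rightarrow> 'a \<Rightarrow> 'b::euclidean_space"
  assumes sub: "subalgebra M F"
    and I: "\<And>t. t \<in> {1..b} \<Longrightarrow> uniform_given F m (I t)"
    and pair: "\<And>s t. s \<in> {1..b} \<Longrightarrow> t \<in> {1..b} \<Longrightarrow> s \<noteq> t \<Longrightarrow> uniform_pair_given F m (I s) (I t)"
    and d: "\<And>j. j \<in> {1..m} \<Longrightarrow> d j \<in> borel_measurable F"
      "\<And>j. j \<in> {1..m} \<Longrightarrow> square_integrable M (d j)"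
    and centered: "\<And>\<omega>. \<omega> \<in> space M \<Longrightarrow> (\<Sum>j=1..m. d j \<omega>) = 0"
  shows "expectation (\<lambda>\<omega>. (norm (\<Sum>t=1..b. d (I t \<omega>) \<omega>))\<^sup>2)
    = real b * ((1 / real m) * (\<Sum>j=1..m. expectation (\<lambda>\<omega>. (norm (d j \<omega>))\<^sup>2)))"
proof -
  note sq = square_integrable_sampled[OF sub I d]
  have int: "integrable M (\<lambda>\<omega>. d (I s \<omega>) \<omega> \<bullet> d (I t \<omega>) \<omega>)"
    if "s \<in> {1..b}" "t \<in> {1..b}" for s t
    by (intro integrable_inner sq that)
  have "expectation (\<lambda>\<omega>. (norm (\<Sum>t=1..b. d (I t \<omega>) \<omega>))\<^sup>2)
      = expectation (\<lambda>\<omega>. \<Sum>s=1..b. \<Sum>t=1..b. d (I s \<omega>) \<omega> \<bullet> d (I t \<omega>) \<omega>)"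
    by (simp add: power2_norm_eq_inner inner_sum_left inner_sum_right inner_commute)
  also have "\<dots> = (\<Sum>s=1..b. \<Sum>t=1..b. expectation (\<lambda>\<omega>. d (I s \<omega>) \<omega> \<bullet> d (I t \<omega>) \<omega>))"
    by (subst Bochner_Integration.integral_sum)
      (intro Bochner_Integration.integrable_sum sum.cong refl Bochner_Integration.integral_sum int;
        assumption)+
  also have "\<dots> = (\<Sum>s=1..b. \<Sum>t=1..b.
      if t = s then (1 / real m) * (\<Sum>j=1..m. expectation (\<lambda>\<omega>. (norm (d j \<omega>))\<^sup>2)) else 0)"
  proof (intro sum.cong refl)
    fix s t assume st: "s \<in> {1..b}" "t \<in> {1..b}"
    show "expectation (\<lambda>\<omega>. d (I s \<omega>) \<omega> \<bullet> d (I t \<omega>) \<omega>)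
        = (if t = s then (1 / real m) * (\<Sum>j=1..m. expectation (\<lambda>\<omega>. (norm (d j \<omega>))\<^sup>2)) else 0)"
    proof (cases "t = s")
      case True
      then show ?thesis
        using expectation_sampled(2)[OF sub I[OF st(1)], where h = "\<lambda>j \<omega>. d j \<omega> \<bullet> d j \<omega>"]
          d integrable_inner[OF d(2) d(2)]
        by (simp add: power2_norm_eq_inner)
    next
      case False
      then show ?thesis
        using expectation_sampled_pair_centered[OF sub I[OF st(1)] I[OF st(2)] pair[OF st] d centered]
        by simp
    qed
  qed
  finally show ?thesis by simp
qed

end

section \<open>A run with the parameters of the convergence theorem\<close>

text \<open>The bound \<open>p / \<mu>\<close> on the stepsize and the bound on the batchsize appear multiplied out, the
  form in which the estimates use them.\<close>

locale br_lsvrg_convex =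
  br_lsvrg M n \<G> m f \<gamma> b p x0 S A K past sent J coin U x w g
  for M :: "'o measure" and n :: nat and \<G> :: "nat set" and m :: nat
    and f :: "nat \<Rightarrow> 'a::euclidean_space \<Rightarrow> real"
    and \<gamma> :: real and b :: nat and p :: real and x0 :: 'a
    and S :: "'s measure" and A :: "'s \<Rightarrow> (nat \<Rightarrow> 'a) \<Rightarrow> 'a" and K :: nat
    and past sent :: "nat \<Rightarrow> 'o measure"
    and J :: "nat \<Rightarrow> nat \<Rightarrow> nat \<Rightarrow> 'o \<Rightarrow> nat"
    and coin :: "nat \<Rightarrow> nat \<Rightarrow> 'o set"
    and U :: "nat \<Rightarrow> 'o \<Rightarrow> 's"
    and x :: "nat \<Rightarrow> 'o \<Rightarrow> 'a"
    and w g :: "nat \<Rightarrow> nat \<Rightarrow> 'o \<Rightarrow> 'a" +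
  fixes L \<mu> \<delta> c :: real and xs :: 'a
  assumes m: "m \<ge> 1" and L: "L > 0" and \<mu>: "\<mu> > 0"
    and convex: "j \<in> {1..m} \<Longrightarrow> convex_differentiable (f j)"
    and smooth: "j \<in> {1..m} \<Longrightarrow> smooth L (f j)"
    and strongly_convex: "strongly_convex \<mu> (average m f)"
    and minimizer: "average m f xs \<le> average m f y"
    and \<delta>: "0 \<le> \<delta>" and c: "c > 0"
    and \<G>: "\<G> \<subseteq> {1..n}" "card \<G> \<ge> 2" "real (card \<G>) \<ge> (1 - \<delta>) * real n"
    and p: "0 < p" "p \<le> 1"
    and \<gamma>: "0 < \<gamma>" "\<gamma> \<le> 1 / (144 * L)" "\<gamma> * \<mu> \<le> p"
    and b: "b \<ge> 1" "c * \<delta> \<le> real b * (\<gamma> * \<mu>)"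
    and aggregator: "agnostic_robust_aggregator n \<delta> c S A"
begin

definition gap :: "'a \<Rightarrow> real" where
  "gap y = average m f y - average m f xs"

lemma gap_nonneg: "0 \<le> gap y"
  using minimizer[of y] by (simp add: gap_def)

lemma summand_differentiable: "j \<in> {1..m} \<Longrightarrow> f j differentiable (at y)"
  using smooth by (simp add: smooth_def)

lemma GDERIV_objective:
  "GDERIV (average m f) y :> (1 / real m) *\<^sub>R (\<Sum>j=1..m. gradient (f j) y)"
  by (rule average_GDERIV) (use summand_differentiable in blast)

lemma gradient_objective:
  "gradient (average m f) y = (1 / real m) *\<^sub>R (\<Sum>j=1..m. gradient (f j) y)"
  by (rule gradient_eqI) (rule GDERIV_objective)

lemma sum_gradients_minimizer: "(\<Sum>j=1..m. gradient (f j) xs) = 0"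
proof -
  have "(1 / real m) *\<^sub>R (\<Sum>j=1..m. gradient (f j) xs) = 0"
    by (rule gradient_at_minimum[OF GDERIV_objective]) (use minimizer in blast)
  then show ?thesis using m by simp
qed

text \<open>Summed over \<open>j\<close>, the linear terms of the Bregman divergences cancel since the gradients of the
  summands add up to zero at the minimizer.\<close>

lemma gradients_deviation_le_gap:
  "(1 / real m) * (\<Sum>j=1..m. (norm (gradient (f j) y - gradient (f j) xs))\<^sup>2) \<le> 2 * L * gap y"
proof -
  have "(\<Sum>j=1..m. (norm (gradient (f j) y - gradient (f j) xs))\<^sup>2)
      \<le> (\<Sum>j=1..m. 2 * L * (f j y - f j xs - gradient (f j) xs \<bullet> (y - xs)))"
    using convex smooth L by (intro sum_mono gradient_diff_bregman_bound) auto
  also have "\<dots> = 2 * L * ((\<Sum>j=1..m. f j y) - (\<Sum>j=1..m. f j xs)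
      - (\<Sum>j=1..m. gradient (f j) xs) \<bullet> (y - xs))"
    by (simp add: sum_distrib_left[symmetric] sum_subtractf inner_sum_left)
  also have "\<dots> = 2 * L * (real m * gap y)"
    using m unfolding sum_gradients_minimizer by (simp add: gap_def average_def field_simps)
  finally show ?thesis
    using m by (simp add: field_simps)
qed

lemma gradient_objective_sq_le_gap: "(norm (gradient (average m f) y))\<^sup>2 \<le> 2 * L * gap y"
proof -
  have "gradient (average m f) y
      = (1 / real (card {1..m})) *\<^sub>R (\<Sum>j=1..m. gradient (f j) y - gradient (f j) xs)"
    using sum_gradients_minimizer by (simp add: gradient_objective sum_subtractf)
  then have "(norm (gradient (average m f) y))\<^sup>2
      \<le> (1 / real (card {1..m})) * (\<Sum>j=1..m. (norm (gradient (f j) y - gradient (f j) xs))\<^sup>2)"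
    using m norm_mean_sq_le[of "{1..m}" "\<lambda>j. gradient (f j) y - gradient (f j) xs"] by simp
  also have "\<dots> \<le> 2 * L * gap y"
    using gradients_deviation_le_gap by simp
  finally show ?thesis .
qed

lemma gradient_objective_inner_ge:
  "gap y + \<mu> / 2 * (norm (y - xs))\<^sup>2 \<le> gradient (average m f) y \<bullet> (y - xs)"
proof -
  have "average m f y + gradient (average m f) y \<bullet> (xs - y) + \<mu> / 2 * (norm (xs - y))\<^sup>2
      \<le> average m f xs"
    using strongly_convex unfolding strongly_convex_def by blast
  then show ?thesis
    by (simp add: gap_def inner_diff_right norm_minus_commute)
qed

lemma gradient_measurable:
  assumes "j \<in> {1..m}"
  shows "gradient (f j) \<in> borel_measurable borel"
proof -
  have "L-lipschitz_on UNIV (gradient (f j))"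
    using smooth[OF assms] L unfolding smooth_def by (auto simp: lipschitz_on_def dist_norm)
  then show ?thesis
    by (intro borel_measurable_continuous_onI lipschitz_on_continuous_on)
qed

lemma gradient_objective_measurable: "gradient (average m f) \<in> borel_measurable borel"
  unfolding gradient_objective[abs_def]
  by (intro borel_measurable_scaleR borel_measurable_const borel_measurable_sum gradient_measurable)

lemma gap_measurable: "gap \<in> borel_measurable borel"
proof -
  have "continuous_on UNIV (average m f)"
    using GDERIV_objective has_derivative_continuous
    unfolding gderiv_def continuous_on_eq_continuous_within by blast
  then show ?thesis
    unfolding gap_def[abs_def] by (intro borel_measurable_diff borel_measurable_continuous_onI) auto
qed

lemma batch_pos: "real b > 0"
  using b by simp

lemma finite_\<G>: "finite \<G>"
  using \<G>(1) finite_subset by blast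

lemma card_\<G>_pos: "real (card \<G>) > 0"
  using \<G>(2) by simp

subsection \<open>Measurability\<close>

lemma past_le_sent:
  "k < K \<Longrightarrow> h \<in> past k \<rightarrow>\<^sub>M N \<Longrightarrow> h \<in> sent k \<rightarrow>\<^sub>M N"
  using measurable_from_subalg past_sent by blast

lemma sent_le_past:
  "k < K \<Longrightarrow> h \<in> sent k \<rightarrow>\<^sub>M N \<Longrightarrow> h \<in> past (Suc k) \<rightarrow>\<^sub>M N"
  using measurable_from_subalg sent_past by blast

lemma past_le_M:
  "k \<le> K \<Longrightarrow> h \<in> past k \<rightarrow>\<^sub>M N \<Longrightarrow> h \<in> M \<rightarrow>\<^sub>M N"
  using measurable_from_subalg past_subalgebra by blast

lemma sent_le_M:
  "k < K \<Longrightarrow> h \<in> sent k \<rightarrow>\<^sub>M N \<Longrightarrow> h \<in> M \<rightarrow>\<^sub>M N"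
  using past_le_M[OF Suc_leI] sent_le_past by blast

lemma space_past: "k \<le> K \<Longrightarrow> space (past k) = space M"
  using past_subalgebra by (simp add: subalgebra_def)

lemma space_sent: "k < K \<Longrightarrow> space (sent k) = space M"
  using past_sent[of k] space_past[of k] by (simp add: subalgebra_def)

definition messages :: "nat \<Rightarrow> 'o \<Rightarrow> nat \<Rightarrow> 'a" where
  "messages k \<omega> = (\<lambda>i\<in>{1..n}. g i k \<omega>)"

definition iterates_measurable :: "nat \<Rightarrow> bool" where
  "iterates_measurable k \<longleftrightarrow>
     x k \<in> borel_measurable (past k) \<and> (\<forall>i\<in>\<G>. w i k \<in> borel_measurable (past k))"

text \<open>A sampled gradient depends on a random index, which takes countably many values, and on a point known
  from the past.\<close>

lemma message_measurable_of_iterates: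
  assumes k: "k < K" and meas: "iterates_measurable k" and i: "i \<in> {1..n}"
  shows "g i k \<in> borel_measurable (sent k)"
proof (cases "i \<in> \<G>")
  case True
  have xw: "x k \<in> borel_measurable (sent k)" "w i k \<in> borel_measurable (sent k)"
    using meas True k past_le_sent unfolding iterates_measurable_def by blast+
  have sampled: "(\<lambda>\<omega>. gradient (f (J i k t \<omega>)) (y \<omega>)) \<in> borel_measurable (sent k)"
    if "t \<in> {1..b}" "y \<in> borel_measurable (sent k)" for t y
    using J_measurable[OF k True that(1)]
  proof (rule measurable_compose_countable'[where f = "\<lambda>j \<omega>. gradient (f j) (y \<omega>)", rotated])
    show "(\<lambda>\<omega>. gradient (f j) (y \<omega>)) \<in> borel_measurable (sent k)" if "j \<in> {1..m}" for j
      using measurable_compose[OF \<open>y \<in> borel_measurable (sent k)\<close> gradient_measurable[OF that]] .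
  qed simp
  have "(\<lambda>\<omega>. (1 / real b) *\<^sub>R (\<Sum>t=1..b. gradient (f (J i k t \<omega>)) (x k \<omega>)
                                     - gradient (f (J i k t \<omega>)) (w i k \<omega>))
          + gradient (average m f) (w i k \<omega>)) \<in> borel_measurable (sent k)"
    by (intro borel_measurable_add borel_measurable_scaleR borel_measurable_const
        borel_measurable_sum borel_measurable_diff sampled xw
        measurable_compose[OF xw(2) gradient_objective_measurable])
  then show ?thesis
    using g_regular[OF k True] space_sent[OF k] by (subst measurable_cong) auto
next
  case False
  then show ?thesis using g_byzantine[OF k] i by blast
qed

lemma aggregator_measurable:
  "(\<lambda>(s, v). A s v) \<in> borel_measurable (S \<Otimes>\<^sub>M PiM {1..n} (\<lambda>_. borel))"
  using aggregator by (simp add: agnostic_robust_aggregator_def)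

lemma iterates_measurable_Suc:
  assumes k: "k < K" and meas: "iterates_measurable k"
  shows "iterates_measurable (Suc k)"
  unfolding iterates_measurable_def
proof (intro conjI ballI)
  have sp: "space (past (Suc k)) = space M"
    using space_past k by simp
  have [measurable]: "x k \<in> borel_measurable (past (Suc k))"
    using meas k past_le_sent sent_le_past unfolding iterates_measurable_def by blast
  have [measurable]: "messages k \<in> past (Suc k) \<rightarrow>\<^sub>M PiM {1..n} (\<lambda>_. borel)"
    unfolding messages_def[abs_def]
    using message_measurable_of_iterates[OF k meas] sent_le_past[OF k]
    by (intro measurable_restrict) blast
  note U_measurable[OF k, measurable] aggregator_measurable[measurable]
  have "(\<lambda>\<omega>. x k \<omega> - \<gamma> *\<^sub>R (\<lambda>(s, v). A s v) (U k \<omega>, messages k \<omega>)) \<in> borel_measurable (past (Suc k))"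
    by measurable
  then show "x (Suc k) \<in> borel_measurable (past (Suc k))"
    using x_step[OF k] sp by (subst measurable_cong) (auto simp: messages_def)
  fix i assume i: "i \<in> \<G>"
  have [measurable]: "w i k \<in> borel_measurable (past (Suc k))"
    using meas k i past_le_sent sent_le_past unfolding iterates_measurable_def by blast
  note coin_event[OF k i, measurable]
  have "(\<lambda>\<omega>. if \<omega> \<in> coin i k then x k \<omega> else w i k \<omega>) \<in> borel_measurable (past (Suc k))"
    by measurable
  then show "w i (Suc k) \<in> borel_measurable (past (Suc k))"
    using w_step[OF k i] sp by (subst measurable_cong) auto
qed

lemma iterates_measurable:
  "k \<le> K \<Longrightarrow> iterates_measurable k"
proof (induction k)
  case 0
  have "x 0 \<in> borel_measurable (past 0)" 
    using x_init space_past[of 0] by (subst measurable_cong[of _ _ "\<lambda>_. x0"]) auto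
  moreover have "w i 0 \<in> borel_measurable (past 0)" if "i \<in> \<G>" for i
    using w_init[OF _ that] space_past[of 0] by (subst measurable_cong[of _ _ "\<lambda>_. x0"]) auto
  ultimately show ?case
    by (simp add: iterates_measurable_def)
qed (use iterates_measurable_Suc in simp)

lemma x_measurable: "k \<le> K \<Longrightarrow> x k \<in> borel_measurable (past k)"
  and w_measurable: "k \<le> K \<Longrightarrow> i \<in> \<G> \<Longrightarrow> w i k \<in> borel_measurable (past k)"
  using iterates_measurable by (auto simp: iterates_measurable_def)

lemma message_measurable: "k < K \<Longrightarrow> i \<in> {1..n} \<Longrightarrow> g i k \<in> borel_measurable (sent k)"
  using message_measurable_of_iterates iterates_measurable by simp

lemma messages_measurable:
  "k < K \<Longrightarrow> messages k \<in> sent k \<rightarrow>\<^sub>M PiM {1..n} (\<lambda>_. borel)"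
  unfolding messages_def[abs_def] by (intro measurable_restrict message_measurable)

subsection \<open>Sampling\<close>

lemma prob_sample:
  assumes "k < K" "i \<in> \<G>" "t \<in> {1..b}" "j \<in> {1..m}"
  shows "prob {\<omega> \<in> space M. J i k t \<omega> = j} = 1 / real m"
proof -
  have J: "J i k t \<in> M \<rightarrow>\<^sub>M count_space {1..m}"
    using J_measurable sent_le_M assms by blast
  have "prob {\<omega> \<in> space M. J i k t \<omega> = j} = measure (distr M (count_space {1..m}) (J i k t)) {j}"
    using J assms(4) by (subst measure_distr) (auto intro!: arg_cong[where f = prob])
  also have "\<dots> = 1 / real m"
    using assms(4) unfolding J_uniform[OF assms(1-3)]
    by (subst measure_uniform_count_measure) auto
  finally show ?thesis .
qed

lemma sample_event:
  assumes "k < K" "i \<in> \<G>" "t \<in> {1..b}"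
  shows "{\<omega> \<in> space M. J i k t \<omega> = j} \<in> events"
proof -
  have "{\<omega> \<in> space M. J i k t \<omega> = j} = J i k t -` ({j} \<inter> {1..m}) \<inter> space M"
    using measurable_space[OF sent_le_M[OF assms(1) J_measurable[OF assms]]] by auto
  then show ?thesis
    using measurable_sets[OF sent_le_M[OF assms(1) J_measurable[OF assms]], of "{j} \<inter> {1..m}"] by simp
qed

lemma samples_uniform_given_past:
  assumes k: "k < K" and i: "i \<in> \<G>" and t: "t \<in> {1..b}"
  shows "uniform_given (past k) m (J i k t)"
  unfolding uniform_given_def constant_cond_prob_def
proof (intro conjI ballI)
  show "J i k t \<in> M \<rightarrow>\<^sub>M count_space {1..m}"
    using J_measurable sent_le_M assms by blast
  fix j assume j: "j \<in> {1..m}"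
  let ?E = "{\<omega> \<in> space M. J i k t \<omega> = j}"
  show "?E \<in> events"
    using sample_event assms by blast
  fix B assume B: "B \<in> sets (past k)"
  let ?I = "{None, Some (i, t)}"
  let ?X = "case_option B (\<lambda>_. ?E)"
  have "?E = J i k t -` {j} \<inter> space M"
    by auto
  then have "?E \<in> {J i k t -` B \<inter> space M | B. B \<subseteq> {1..m}}"
    using j by blast
  then have "prob (\<Inter>a\<in>?I. ?X a) = (\<Prod>a\<in>?I. prob (?X a))"
    using B i t by (intro indep_setsD[OF J_indep[OF k]]) auto
  then show "prob (B \<inter> ?E) = 1 / real m * prob B"
    using prob_sample[OF assms j] by simp
qed

lemma sample_pairs_uniform_given_past:
  assumes k: "k < K" and i: "i \<in> \<G>" and st: "s \<in> {1..b}" "t \<in> {1..b}" "s \<noteq> t"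
  shows "uniform_pair_given (past k) m (J i k s) (J i k t)"
  unfolding uniform_pair_given_def constant_cond_prob_def
proof (intro conjI ballI)
  fix j l assume j: "j \<in> {1..m}" and l: "l \<in> {1..m}"
  let ?E = "{\<omega> \<in> space M. J i k s \<omega> = j}"
  let ?E' = "{\<omega> \<in> space M. J i k t \<omega> = l}"
  have EE': "{\<omega> \<in> space M. J i k s \<omega> = j \<and> J i k t \<omega> = l} = ?E \<inter> ?E'"
    by auto
  show "{\<omega> \<in> space M. J i k s \<omega> = j \<and> J i k t \<omega> = l} \<in> events"
    unfolding EE' using sample_event k i st by blast
  fix B assume B: "B \<in> sets (past k)"
  let ?I = "{None, Some (i, s), Some (i, t)}"
  let ?X = "case_option B (\<lambda>a. if a = (i, s) then ?E else ?E')"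
  have "?E = J i k s -` {j} \<inter> space M" "?E' = J i k t -` {l} \<inter> space M"
    by auto
  then have "?E \<in> {J i k s -` B \<inter> space M | B. B \<subseteq> {1..m}}"
    "?E' \<in> {J i k t -` B \<inter> space M | B. B \<subseteq> {1..m}}"
    using j l by blast+
  then have "prob (\<Inter>a\<in>?I. ?X a) = (\<Prod>a\<in>?I. prob (?X a))"
    using B i st by (intro indep_setsD[OF J_indep[OF k]]) auto
  moreover have "(\<Inter>a\<in>?I. ?X a) = B \<inter> {\<omega> \<in> space M. J i k s \<omega> = j \<and> J i k t \<omega> = l}"
    using st by auto
  moreover have "(\<Prod>a\<in>?I. prob (?X a)) = prob B * (prob ?E * prob ?E')"
    using st by simp
  ultimately show "prob (B \<inter> {\<omega> \<in> space M. J i k s \<omega> = j \<and> J i k t \<omega> = l})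
      = 1 / (real m)\<^sup>2 * prob B"
    using prob_sample[OF k i st(1) j] prob_sample[OF k i st(2) l] by (simp add: power2_eq_square)
qed

lemma coin_given_past:
  assumes "k < K" "i \<in> \<G>"
  shows "constant_cond_prob (past k) (coin i k) p"
proof (rule constant_cond_probI_cond_exp)
  show "subalgebra M (past k)"
    using past_subalgebra assms by simp
  show "coin i k \<in> events"
    using coin_event[OF assms] past_subalgebra[of "Suc k"] assms by (auto simp: subalgebra_def)
  show "AE \<omega> in M. real_cond_exp M (past k) (indicator (coin i k)) \<omega> = p"
    using coin_prob assms by blast
qed

section \<open>Aggregation error\<close>

definition mean_message :: "nat \<Rightarrow> 'o \<Rightarrow> 'a" where
  "mean_message k \<omega> = (1 / real (card \<G>)) *\<^sub>R (\<Sum>i\<in>\<G>. g i k \<omega>)"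

definition aggregation_error :: "nat \<Rightarrow> 'o \<Rightarrow> 'a" where
  "aggregation_error k \<omega> = A (U k \<omega>) (messages k \<omega>) - mean_message k \<omega>"

lemma U_measurable_M: "k < K \<Longrightarrow> U k \<in> M \<rightarrow>\<^sub>M S"
  using past_le_M[OF Suc_leI] U_measurable by blast

text \<open>The internal randomness of the server is independent of \<open>sent k\<close>, hence of all the messages,
  Byzantine ones included. This is what makes the aggregator's guarantee, stated for a product measure,
  applicable to the run.\<close>

lemma joint_law:
  assumes k: "k < K"
  defines "P \<equiv> PiM {1..n} (\<lambda>_. borel :: 'a measure)"
  shows "S \<Otimes>\<^sub>M distr M P (messages k) = distr M (S \<Otimes>\<^sub>M P) (\<lambda>\<omega>. (U k \<omega>, messages k \<omega>))"
proof (rule pair_measure_eqI)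
  note U_measurable_M[OF k, measurable]
  have msg: "messages k \<in> sent k \<rightarrow>\<^sub>M P"
    using messages_measurable[OF k] by (simp add: P_def)
  then have [measurable]: "messages k \<in> M \<rightarrow>\<^sub>M P"
    using sent_le_M[OF k] by blast
  have S: "prob_space S"
    using aggregator by (simp add: agnostic_robust_aggregator_def)
  then show "sigma_finite_measure S"
    by (rule prob_space_imp_sigma_finite)
  show "sigma_finite_measure (distr M P (messages k))"
    by (intro prob_space_imp_sigma_finite prob_space_distr) measurable
  show "sets (S \<Otimes>\<^sub>M distr M P (messages k)) = sets (distr M (S \<Otimes>\<^sub>M P) (\<lambda>\<omega>. (U k \<omega>, messages k \<omega>)))"
    by (simp cong: sets_pair_measure_cong)
  fix C D assume C: "C \<in> sets S" and D: "D \<in> sets (distr M P (messages k))"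
  then have [measurable]: "C \<in> sets S" "D \<in> sets P" by auto
  let ?U = "U k -` C \<inter> space M" and ?V = "messages k -` D \<inter> space M"
  have "?V \<in> sets (sent k)"
    using measurable_sets[OF msg \<open>D \<in> sets P\<close>] space_sent[OF k] by simp
  then have "prob (?V \<inter> ?U) = prob ?V * prob ?U"
    using indep_setD[OF U_indep[OF k]] C by blast
  moreover have "emeasure S C = emeasure M ?U"
    using U_law[OF k] C by (subst U_law[OF k, symmetric], subst emeasure_distr) auto
  moreover have "(\<lambda>\<omega>. (U k \<omega>, messages k \<omega>)) -` (C \<times> D) \<inter> space M = ?V \<inter> ?U"
    by auto
  ultimately show "emeasure S C * emeasure (distr M P (messages k)) D
      = emeasure (distr M (S \<Otimes>\<^sub>M P) (\<lambda>\<omega>. (U k \<omega>, messages k \<omega>))) (C \<times> D)"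
    by (simp add: emeasure_distr emeasure_eq_measure ennreal_mult[symmetric] mult.commute)
qed

lemma message_component: "i \<in> \<G> \<Longrightarrow> messages k \<omega> i = g i k \<omega>"
  using \<G>(1) by (auto simp: messages_def)

text \<open>The guarantee of the aggregator for the law of the messages, with \<open>\<rho>\<^sup>2 = D\<close>,
  pulled back to the sample space.\<close>

lemma aggregation_error_bound:
  assumes k: "k < K" and sq: "\<And>i. i \<in> \<G> \<Longrightarrow> square_integrable M (g i k)"
  defines "D \<equiv> 1 / (real (card \<G>) * (real (card \<G>) - 1)) *
      (\<Sum>i\<in>\<G>. \<Sum>l\<in>\<G>. expectation (\<lambda>\<omega>. (norm (g i k \<omega> - g l k \<omega>))\<^sup>2))"
  shows "square_integrable M (aggregation_error k)"
    and "expectation (\<lambda>\<omega>. (norm (aggregation_error k \<omega>))\<^sup>2) \<le> c * \<delta> * D"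
proof -
  let ?P = "PiM {1..n} (\<lambda>_. borel :: 'a measure)"
  let ?N = "distr M ?P (messages k)"
  let ?r = "1 / (real (card \<G>) * (real (card \<G>) - 1))"
  let ?err = "\<lambda>(s, v). ennreal ((norm (A s v - (1 / real (card \<G>)) *\<^sub>R (\<Sum>i\<in>\<G>. v i)))\<^sup>2)"
  have r: "0 \<le> ?r" using \<G>(2) by simp
  have D: "0 \<le> D"
    unfolding D_def using r by (intro mult_nonneg_nonneg sum_nonneg integral_nonneg) auto
  have msg[measurable]: "messages k \<in> M \<rightarrow>\<^sub>M ?P"
    using sent_le_M[OF k messages_measurable[OF k]] .
  note U_measurable_M[OF k, measurable] aggregator_measurable[measurable]
  have comp: "(\<lambda>v. v i) \<in> ?P \<rightarrow>\<^sub>M borel" if "i \<in> \<G>" for i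
    using \<G>(1) that by (intro measurable_component_singleton) auto
  have comp2: "(\<lambda>z. snd z i) \<in> S \<Otimes>\<^sub>M ?P \<rightarrow>\<^sub>M borel" if "i \<in> \<G>" for i
    using measurable_compose[OF measurable_snd comp[OF that]] .
  have pair: "(\<integral>\<^sup>+v. ennreal ((norm (v i - v l))\<^sup>2) \<partial>?N)
      = ennreal (expectation (\<lambda>\<omega>. (norm (g i k \<omega> - g l k \<omega>))\<^sup>2))" if "i \<in> \<G>" "l \<in> \<G>" for i l
  proof -
    have [measurable]: "(\<lambda>v. v i) \<in> ?P \<rightarrow>\<^sub>M borel" "(\<lambda>v. v l) \<in> ?P \<rightarrow>\<^sub>M borel"
      using comp that by auto
    have "(\<integral>\<^sup>+v. ennreal ((norm (v i - v l))\<^sup>2) \<partial>?N)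
        = (\<integral>\<^sup>+\<omega>. ennreal ((norm (g i k \<omega> - g l k \<omega>))\<^sup>2) \<partial>M)"
    proof (subst nn_integral_distr[OF msg])
      show "(\<lambda>v. ennreal ((norm (v i - v l))\<^sup>2)) \<in> borel_measurable ?N"
        by measurable
    qed (simp add: message_component that)
    also have "\<dots> = ennreal (expectation (\<lambda>\<omega>. (norm (g i k \<omega> - g l k \<omega>))\<^sup>2))"
      using square_integrable_norm_sq[OF square_integrable_diff[OF sq sq]] that
      by (intro nn_integral_eq_integral) auto
    finally show ?thesis .
  qed
  have "ennreal ?r * (\<Sum>i\<in>\<G>. \<Sum>l\<in>\<G>. \<integral>\<^sup>+v. ennreal ((norm (v i - v l))\<^sup>2) \<partial>?N)
      = ennreal ?r * ennreal (\<Sum>i\<in>\<G>. \<Sum>l\<in>\<G>. expectation (\<lambda>\<omega>. (norm (g i k \<omega> - g l k \<omega>))\<^sup>2))"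
    by (simp add: pair sum_ennreal sum_nonneg del: One_nat_def)
  also have "\<dots> = ennreal D"
    unfolding D_def by (intro ennreal_mult'[symmetric] r)
  also have "\<dots> = ennreal ((sqrt D)\<^sup>2)"
    using D by simp
  finally have premise:
    "ennreal ?r * (\<Sum>i\<in>\<G>. \<Sum>l\<in>\<G>. \<integral>\<^sup>+v. ennreal ((norm (v i - v l))\<^sup>2) \<partial>?N) \<le> ennreal ((sqrt D)\<^sup>2)"
    by simp
  note robustness = aggregator[unfolded agnostic_robust_aggregator_def, THEN conjunct2,
      THEN conjunct2, THEN spec, THEN spec, THEN spec, THEN mp]
  have "integral\<^sup>N (S \<Otimes>\<^sub>M ?N) ?err \<le> ennreal (c * \<delta> * (sqrt D)\<^sup>2)"
  proof (rule robustness, intro conjI)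
    show "prob_space ?N"
      using prob_space_distr[OF msg] .
    show "0 \<le> sqrt D"
      using D by simp
  qed (rule sets_distr \<G> premise)+
  also have "integral\<^sup>N (S \<Otimes>\<^sub>M ?N) ?err = (\<integral>\<^sup>+\<omega>. ?err (U k \<omega>, messages k \<omega>) \<partial>M)"
  proof -
    have "(\<lambda>z. \<Sum>i\<in>\<G>. snd z i) \<in> borel_measurable (S \<Otimes>\<^sub>M ?P)"
      by (intro borel_measurable_sum comp2)
    moreover have "(\<lambda>z. A (fst z) (snd z)) \<in> borel_measurable (S \<Otimes>\<^sub>M ?P)"
      using aggregator_measurable by (simp add: case_prod_beta)
    ultimately have dev: "(\<lambda>z. A (fst z) (snd z) - (1 / real (card \<G>)) *\<^sub>R (\<Sum>i\<in>\<G>. snd z i))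
        \<in> borel_measurable (S \<Otimes>\<^sub>M ?P)"
      by measurable
    have "(\<lambda>y::'a. ennreal ((norm y)\<^sup>2)) \<in> borel_measurable borel"
      by measurable
    from measurable_compose[OF dev this] have "?err \<in> borel_measurable (S \<Otimes>\<^sub>M ?P)"
      by (simp add: case_prod_beta)
    then show ?thesis
      unfolding joint_law[OF k]
      by (intro nn_integral_distr measurable_Pair U_measurable_M[OF k] msg) simp
  qed
  also have "\<dots> = (\<integral>\<^sup>+\<omega>. ennreal ((norm (aggregation_error k \<omega>))\<^sup>2) \<partial>M)"
    by (simp add: aggregation_error_def mean_message_def message_component)
  finally have bound:
    "(\<integral>\<^sup>+\<omega>. ennreal ((norm (aggregation_error k \<omega>))\<^sup>2) \<partial>M) \<le> ennreal (c * \<delta> * D)"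
    using D by simp
  have [measurable]: "g i k \<in> borel_measurable M" if "i \<in> \<G>" for i
    using square_integrable_measurable sq that by blast
  have "(\<lambda>\<omega>. (\<lambda>(s, v). A s v) (U k \<omega>, messages k \<omega>) - mean_message k \<omega>) \<in> borel_measurable M"
    unfolding mean_message_def by measurable
  then have [measurable]: "aggregation_error k \<in> borel_measurable M"
    by (simp add: aggregation_error_def[abs_def])
  have "integrable M (\<lambda>\<omega>. (norm (aggregation_error k \<omega>))\<^sup>2)"
    using bound by (intro integrableI_bounded) (auto simp: order_le_less_trans)
  then show "square_integrable M (aggregation_error k)"
    by (simp add: square_integrable_def)
  then show "expectation (\<lambda>\<omega>. (norm (aggregation_error k \<omega>))\<^sup>2) \<le> c * \<delta> * D"
    using bound D c \<delta> by (subst (asm) nn_integral_eq_integral)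
      (auto simp: square_integrable_def ennreal_le_iff)
qed

section \<open>Bias and variance of the regular messages\<close>

text \<open>The mean of this quantity over the reference points of the regular workers is \<open>\<sigma>\<^sup>2\<close>;
  at \<open>x k\<close> it is the value that a replaced reference point contributes in the next iteration.\<close>

definition gradient_deviation :: "'a \<Rightarrow> real" where
  "gradient_deviation y = (1 / real m) * (\<Sum>j=1..m. (norm (gradient (f j) y - gradient (f j) xs))\<^sup>2)"

lemma gradient_deviation_nonneg: "0 \<le> gradient_deviation y"
  by (simp add: gradient_deviation_def sum_nonneg)

lemma sigma_sq_eq: "sigma_sq \<G> m f xs v = (1 / real (card \<G>)) * (\<Sum>i\<in>\<G>. gradient_deviation (v i))"
  by (simp add: sigma_sq_def gradient_deviation_def sum_distrib_left divide_simps)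

lemma square_integrable_gradient:
  assumes "j \<in> {1..m}" and Y: "square_integrable M Y"
  shows "square_integrable M (\<lambda>\<omega>. gradient (f j) (Y \<omega>))"
proof -
  have "square_integrable M (\<lambda>\<omega>. gradient (f j) (Y \<omega>) - gradient (f j) xs)"
  proof (rule square_integrable_dominated)
    show "square_integrable M (\<lambda>\<omega>. Y \<omega> - xs)"
      by (intro square_integrable_diff Y square_integrable_const)
    show "(\<lambda>\<omega>. gradient (f j) (Y \<omega>) - gradient (f j) xs) \<in> borel_measurable M"
      using measurable_compose[OF square_integrable_measurable[OF Y] gradient_measurable[OF assms(1)]]
      by (intro borel_measurable_diff) auto
    show "norm (gradient (f j) (Y \<omega>) - gradient (f j) xs) \<le> L * norm (Y \<omega> - xs)" for \<omega>
      using smooth[OF assms(1)] unfolding smooth_def by blast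
  qed
  from square_integrable_add[OF this square_integrable_const[of "gradient (f j) xs"]]
  show ?thesis by simp
qed

lemma square_integrable_gradient_objective:
  "square_integrable M Y \<Longrightarrow> square_integrable M (\<lambda>\<omega>. gradient (average m f) (Y \<omega>))"
  unfolding gradient_objective
  by (intro square_integrable_scaleR square_integrable_sum square_integrable_gradient)

lemma integrable_gradient_deviation:
  assumes "square_integrable M Y"
  shows "integrable M (\<lambda>\<omega>. gradient_deviation (Y \<omega>))"
  unfolding gradient_deviation_def
  by (intro integrable_mult_right Bochner_Integration.integrable_sum square_integrable_norm_sq
      square_integrable_diff square_integrable_gradient square_integrable_const assms)

text \<open>The gap of a square-integrable point is integrable since it lies between \<open>0\<close> and
  \<open>\<langle>\<nabla>f y, y - xs\<rangle>\<close>, a product of two square-integrable vectors.\<close>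

lemma integrable_gap:
  assumes Y: "square_integrable M Y"
  shows "integrable M (\<lambda>\<omega>. gap (Y \<omega>))"
proof (rule Bochner_Integration.integrable_bound)
  show "integrable M (\<lambda>\<omega>. gradient (average m f) (Y \<omega>) \<bullet> (Y \<omega> - xs))"
    by (intro integrable_inner square_integrable_gradient_objective square_integrable_diff
        square_integrable_const Y)
  show "(\<lambda>\<omega>. gap (Y \<omega>)) \<in> borel_measurable M"
    using measurable_compose[OF square_integrable_measurable[OF Y] gap_measurable] .
  have "gap y \<le> gradient (average m f) y \<bullet> (y - xs)" for y
    using gradient_objective_inner_ge[of y] \<mu> by (smt (verit) mult_nonneg_nonneg divide_nonneg_nonneg zero_le_power2)
  then show "AE \<omega> in M. norm (gap (Y \<omega>)) \<le> norm (gradient (average m f) (Y \<omega>) \<bullet> (Y \<omega> - xs))"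
    using gap_nonneg by (auto intro: order_trans[OF _ abs_ge_self])
qed

text \<open>The variance-reduced stochastic gradient is \<open>drift\<close> plus a full gradient at the reference point.\<close>

definition drift :: "nat \<Rightarrow> nat \<Rightarrow> nat \<Rightarrow> 'o \<Rightarrow> 'a" where
  "drift i k j \<omega> = gradient (f j) (x k \<omega>) - gradient (f j) (w i k \<omega>)"

definition noise :: "nat \<Rightarrow> nat \<Rightarrow> nat \<Rightarrow> 'o \<Rightarrow> 'a" where
  "noise i k j \<omega> = drift i k j \<omega> - (1 / real m) *\<^sub>R (\<Sum>l=1..m. drift i k l \<omega>)"

lemma sum_noise: "(\<Sum>j=1..m. noise i k j \<omega>) = 0"
  using m by (simp add: noise_def sum_subtractf sum_constant_scaleR)

text \<open>Adding and subtracting the mean drift exhibits the message as the full gradient at \<open>x k\<close> plus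
  an average of centred samples.\<close>

lemma message_eq:
  assumes "k < K" "i \<in> \<G>" "\<omega> \<in> space M"
  shows "g i k \<omega> = gradient (average m f) (x k \<omega>)
    + (1 / real b) *\<^sub>R (\<Sum>t=1..b. noise i k (J i k t \<omega>) \<omega>)"
proof -
  define a where "a = (1 / real m) *\<^sub>R (\<Sum>l=1..m. drift i k l \<omega>)"
  have "a = gradient (average m f) (x k \<omega>) - gradient (average m f) (w i k \<omega>)"
    by (simp add: a_def drift_def gradient_objective sum_subtractf scaleR_diff_right)
  moreover have noise: "noise i k j \<omega> = drift i k j \<omega> - a" for j
    by (simp add: noise_def a_def)
  moreover have "(1 / real b) *\<^sub>R (\<Sum>t=1..b. noise i k (J i k t \<omega>) \<omega>)
      = (1 / real b) *\<^sub>R (\<Sum>t=1..b. drift i k (J i k t \<omega>) \<omega>) - a"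
    unfolding noise using batch_pos by (simp add: sum_subtractf scaleR_diff_right sum_constant_scaleR)
  moreover have "g i k \<omega> = (1 / real b) *\<^sub>R (\<Sum>t=1..b. drift i k (J i k t \<omega>) \<omega>)
      + gradient (average m f) (w i k \<omega>)"
    using g_regular[OF assms] by (simp add: drift_def)
  ultimately show ?thesis by simp
qed

definition iterates_square_integrable :: "nat \<Rightarrow> bool" where
  "iterates_square_integrable k \<longleftrightarrow>
     square_integrable M (x k) \<and> (\<forall>i\<in>\<G>. square_integrable M (w i k))"

lemma noise_measurable:
  assumes "k \<le> K" "i \<in> \<G>" "j \<in> {1..m}"
  shows "noise i k j \<in> borel_measurable (past k)"
  unfolding noise_def[abs_def] drift_def
  using assms
  by (intro borel_measurable_diff borel_measurable_scaleR borel_measurable_const borel_measurable_sum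
      measurable_compose[OF x_measurable gradient_measurable]
      measurable_compose[OF w_measurable gradient_measurable])

lemma square_integrable_drift:
  assumes "iterates_square_integrable k" "i \<in> \<G>" "j \<in> {1..m}"
  shows "square_integrable M (drift i k j)"
  unfolding drift_def[abs_def]
  using assms unfolding iterates_square_integrable_def
  by (intro square_integrable_diff square_integrable_gradient) auto

lemma square_integrable_noise:
  assumes "iterates_square_integrable k" "i \<in> \<G>" "j \<in> {1..m}"
  shows "square_integrable M (noise i k j)"
  unfolding noise_def[abs_def]
  by (intro square_integrable_diff square_integrable_scaleR square_integrable_sum
      square_integrable_drift assms)

lemma square_integrable_noise_sum:
  assumes k: "k < K" and sq: "iterates_square_integrable k" and i: "i \<in> \<G>"
  shows "square_integrable M (\<lambda>\<omega>. \<Sum>t=1..b. noise i k (J i k t \<omega>) \<omega>)"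
proof (rule square_integrable_sum)
  have sub: "subalgebra M (past k)"
    using past_subalgebra k by simp
  fix t assume t: "t \<in> {1..b}"
  show "square_integrable M (\<lambda>\<omega>. noise i k (J i k t \<omega>) \<omega>)"
    by (rule square_integrable_sampled[OF sub samples_uniform_given_past[OF k i t]
          noise_measurable[OF less_imp_le[OF k] i] square_integrable_noise[OF sq i]])
qed

lemma square_integrable_message:
  assumes k: "k < K" and sq: "iterates_square_integrable k" and i: "i \<in> \<G>"
  shows "square_integrable M (g i k)"
proof -
  have "square_integrable M (\<lambda>\<omega>. gradient (average m f) (x k \<omega>)
      + (1 / real b) *\<^sub>R (\<Sum>t=1..b. noise i k (J i k t \<omega>) \<omega>))"
    using sq unfolding iterates_square_integrable_def
    by (intro square_integrable_add square_integrable_scaleR square_integrable_noise_sum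
        square_integrable_gradient_objective assms) auto
  then show ?thesis
    by (rule square_integrable_cong_space[THEN iffD2, rotated]) (rule message_eq[OF k i])
qed

lemma message_unbiased:
  assumes k: "k < K" and sq: "iterates_square_integrable k" and i: "i \<in> \<G>"
    and Y: "Y \<in> borel_measurable (past k)" "square_integrable M Y"
  shows "expectation (\<lambda>\<omega>. Y \<omega> \<bullet> g i k \<omega>)
    = expectation (\<lambda>\<omega>. Y \<omega> \<bullet> gradient (average m f) (x k \<omega>))"
proof -
  let ?s = "\<lambda>\<omega>. \<Sum>t=1..b. noise i k (J i k t \<omega>) \<omega>"
  have "expectation (\<lambda>\<omega>. Y \<omega> \<bullet> g i k \<omega>) = expectation (\<lambda>\<omega>.
      Y \<omega> \<bullet> gradient (average m f) (x k \<omega>) + (1 / real b) * (Y \<omega> \<bullet> ?s \<omega>))"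
    by (intro Bochner_Integration.integral_cong refl) (simp add: message_eq[OF k i] inner_add_right)
  also have "\<dots> = expectation (\<lambda>\<omega>. Y \<omega> \<bullet> gradient (average m f) (x k \<omega>))
      + (1 / real b) * expectation (\<lambda>\<omega>. Y \<omega> \<bullet> ?s \<omega>)"
    using integrable_inner[OF Y(2) square_integrable_noise_sum[OF k sq i]]
      integrable_inner[OF Y(2) square_integrable_gradient_objective, of "x k"] sq
    unfolding iterates_square_integrable_def
    by (subst Bochner_Integration.integral_add) auto
  also have "expectation (\<lambda>\<omega>. Y \<omega> \<bullet> ?s \<omega>) = 0"
  proof (rule minibatch_inner)
    show "subalgebra M (past k)"
      using past_subalgebra k by simp
  qed (use k Y in \<open>auto intro: samples_uniform_given_past i noise_measurable
        square_integrable_noise sq sum_noise simp del: One_nat_def\<close>)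
  finally show ?thesis by simp
qed

text \<open>Pass from \<open>x k\<close> to the reference point through the minimizer.\<close>

lemma drift_sq_le:
  "(1 / real m) * (\<Sum>j=1..m. (norm (drift i k j \<omega>))\<^sup>2)
    \<le> 4 * L * gap (x k \<omega>) + 2 * gradient_deviation (w i k \<omega>)"
proof -
  have "(norm (drift i k j \<omega>))\<^sup>2 \<le> 2 * (norm (gradient (f j) (x k \<omega>) - gradient (f j) xs))\<^sup>2
      + 2 * (norm (gradient (f j) (w i k \<omega>) - gradient (f j) xs))\<^sup>2" for j
    using norm_add_sq_le[of "gradient (f j) (x k \<omega>) - gradient (f j) xs"
        "gradient (f j) xs - gradient (f j) (w i k \<omega>)"]
    by (simp add: drift_def norm_minus_commute)
  then have "(\<Sum>j=1..m. (norm (drift i k j \<omega>))\<^sup>2)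
      \<le> (\<Sum>j=1..m. 2 * (norm (gradient (f j) (x k \<omega>) - gradient (f j) xs))\<^sup>2
      + 2 * (norm (gradient (f j) (w i k \<omega>) - gradient (f j) xs))\<^sup>2)"
    by (rule sum_mono)
  then have "(1 / real m) * (\<Sum>j=1..m. (norm (drift i k j \<omega>))\<^sup>2)
      \<le> (1 / real m) * (\<Sum>j=1..m. 2 * (norm (gradient (f j) (x k \<omega>) - gradient (f j) xs))\<^sup>2
      + 2 * (norm (gradient (f j) (w i k \<omega>) - gradient (f j) xs))\<^sup>2)"
    by (rule mult_left_mono) simp
  also have "\<dots> = 2 * gradient_deviation (x k \<omega>) + 2 * gradient_deviation (w i k \<omega>)"
    by (simp add: gradient_deviation_def sum.distrib sum_distrib_left[symmetric] add_divide_distrib)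
  also have "\<dots> \<le> 4 * L * gap (x k \<omega>) + 2 * gradient_deviation (w i k \<omega>)"
    using gradients_deviation_le_gap[of "x k \<omega>"] unfolding gradient_deviation_def by simp
  finally show ?thesis .
qed

text \<open>Averaging \<open>b\<close> samples divides the second moment of the noise by \<open>b\<close>; centring only
  decreases it, so the noise may be replaced by the drift.\<close>

lemma message_variance:
  assumes k: "k < K" and sq: "iterates_square_integrable k" and i: "i \<in> \<G>"
  shows "expectation (\<lambda>\<omega>. (norm (g i k \<omega> - gradient (average m f) (x k \<omega>)))\<^sup>2)
    \<le> (1 / real b) * (4 * L * expectation (\<lambda>\<omega>. gap (x k \<omega>))
        + 2 * expectation (\<lambda>\<omega>. gradient_deviation (w i k \<omega>)))"
proof -
  let ?s = "\<lambda>\<omega>. \<Sum>t=1..b. noise i k (J i k t \<omega>) \<omega>"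
  have sqx: "square_integrable M (x k)" and sqw: "square_integrable M (w i k)"
    using sq i unfolding iterates_square_integrable_def by auto
  have "expectation (\<lambda>\<omega>. (norm (g i k \<omega> - gradient (average m f) (x k \<omega>)))\<^sup>2)
      = expectation (\<lambda>\<omega>. (1 / real b)\<^sup>2 * (norm (?s \<omega>))\<^sup>2)"
    by (intro Bochner_Integration.integral_cong refl)
      (simp add: message_eq[OF k i] power_divide)
  also have "\<dots> = (1 / real b)\<^sup>2 * expectation (\<lambda>\<omega>. (norm (?s \<omega>))\<^sup>2)"
    by simp
  also have "expectation (\<lambda>\<omega>. (norm (?s \<omega>))\<^sup>2)
      = real b * ((1 / real m) * (\<Sum>j=1..m. expectation (\<lambda>\<omega>. (norm (noise i k j \<omega>))\<^sup>2)))"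
  proof (rule minibatch_second_moment)
    show "subalgebra M (past k)"
      using past_subalgebra k by simp
  qed (use k in \<open>auto intro: samples_uniform_given_past sample_pairs_uniform_given_past i
        noise_measurable square_integrable_noise sq sum_noise simp del: One_nat_def\<close>)
  also have "(1 / real m) * (\<Sum>j=1..m. expectation (\<lambda>\<omega>. (norm (noise i k j \<omega>))\<^sup>2))
      = expectation (\<lambda>\<omega>. (1 / real m) * (\<Sum>j=1..m. (norm (noise i k j \<omega>))\<^sup>2))"
    using square_integrable_norm_sq[OF square_integrable_noise[OF sq i]]
    by (simp add: Bochner_Integration.integral_sum)
  finally have var: "expectation (\<lambda>\<omega>. (norm (g i k \<omega> - gradient (average m f) (x k \<omega>)))\<^sup>2)
      = (1 / real b) * expectation (\<lambda>\<omega>. (1 / real m) * (\<Sum>j=1..m. (norm (noise i k j \<omega>))\<^sup>2))"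
    using batch_pos by (simp add: power2_eq_square)
  have "expectation (\<lambda>\<omega>. (1 / real m) * (\<Sum>j=1..m. (norm (noise i k j \<omega>))\<^sup>2))
      \<le> expectation (\<lambda>\<omega>. 4 * L * gap (x k \<omega>) + 2 * gradient_deviation (w i k \<omega>))"
  proof (rule integral_mono)
    show "integrable M (\<lambda>\<omega>. (1 / real m) * (\<Sum>j=1..m. (norm (noise i k j \<omega>))\<^sup>2))"
      by (intro integrable_mult_right Bochner_Integration.integrable_sum square_integrable_norm_sq
          square_integrable_noise sq i)
    show "integrable M (\<lambda>\<omega>. 4 * L * gap (x k \<omega>) + 2 * gradient_deviation (w i k \<omega>))"
      using integrable_gap[OF sqx] integrable_gradient_deviation[OF sqw] by simp
    fix \<omega>
    have "(\<Sum>j=1..m. (norm (noise i k j \<omega>))\<^sup>2) \<le> (\<Sum>j=1..m. (norm (drift i k j \<omega>))\<^sup>2)"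
      unfolding noise_def using m by (intro mean_centered_sq_le) auto
    then have "(1 / real m) * (\<Sum>j=1..m. (norm (noise i k j \<omega>))\<^sup>2)
        \<le> (1 / real m) * (\<Sum>j=1..m. (norm (drift i k j \<omega>))\<^sup>2)"
      by (rule mult_left_mono) simp
    then show "(1 / real m) * (\<Sum>j=1..m. (norm (noise i k j \<omega>))\<^sup>2)
        \<le> 4 * L * gap (x k \<omega>) + 2 * gradient_deviation (w i k \<omega>)"
      using drift_sq_le by (rule order_trans)
  qed
  also have "\<dots> = 4 * L * expectation (\<lambda>\<omega>. gap (x k \<omega>))
      + 2 * expectation (\<lambda>\<omega>. gradient_deviation (w i k \<omega>))"
    using integrable_gap[OF sqx] integrable_gradient_deviation[OF sqw] by simp
  finally show ?thesis
    unfolding var using batch_pos by (intro mult_left_mono) auto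
qed

section \<open>Mean-square bounds over one iteration\<close>

definition mean_gap :: "nat \<Rightarrow> real" where
  "mean_gap k = expectation (\<lambda>\<omega>. gap (x k \<omega>))"

definition reference_error :: "nat \<Rightarrow> real" where
  "reference_error k = expectation (\<lambda>\<omega>. sigma_sq \<G> m f xs (\<lambda>i. w i k \<omega>))"

lemma iterates_square_integrableD:
  assumes "iterates_square_integrable k"
  shows "square_integrable M (x k)" and "i \<in> \<G> \<Longrightarrow> square_integrable M (w i k)"
  using assms unfolding iterates_square_integrable_def by auto

lemma mean_gap_nonneg: "0 \<le> mean_gap k"
  unfolding mean_gap_def by (intro Bochner_Integration.integral_nonneg gap_nonneg)

lemma reference_error_eq:
  assumes "iterates_square_integrable k"
  shows "reference_error k
    = (1 / real (card \<G>)) * (\<Sum>i\<in>\<G>. expectation (\<lambda>\<omega>. gradient_deviation (w i k \<omega>)))"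
  using integrable_gradient_deviation[OF iterates_square_integrableD(2)[OF assms]]
  by (simp add: reference_error_def sigma_sq_eq Bochner_Integration.integral_sum)

lemma reference_error_nonneg: "0 \<le> reference_error k"
  unfolding reference_error_def sigma_sq_eq
  by (intro Bochner_Integration.integral_nonneg mult_nonneg_nonneg sum_nonneg gradient_deviation_nonneg) auto

definition message_error :: "nat \<Rightarrow> nat \<Rightarrow> real" where
  "message_error i k = expectation (\<lambda>\<omega>. (norm (g i k \<omega> - gradient (average m f) (x k \<omega>)))\<^sup>2)"

lemma mean_message_error:
  assumes k: "k < K" and sq: "iterates_square_integrable k"
  shows "(1 / real (card \<G>)) * (\<Sum>i\<in>\<G>. message_error i k)
    \<le> (1 / real b) * (4 * L * mean_gap k + 2 * reference_error k)"
proof -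
  have "(\<Sum>i\<in>\<G>. message_error i k)
      \<le> (\<Sum>i\<in>\<G>. (1 / real b) * (4 * L * mean_gap k
          + 2 * expectation (\<lambda>\<omega>. gradient_deviation (w i k \<omega>))))"
    unfolding message_error_def mean_gap_def by (intro sum_mono message_variance k sq)
  also have "\<dots> = (1 / real b) * (real (card \<G>) * (4 * L * mean_gap k)
      + 2 * (\<Sum>i\<in>\<G>. expectation (\<lambda>\<omega>. gradient_deviation (w i k \<omega>))))"
    by (simp add: sum_distrib_left[symmetric] sum.distrib sum_divide_distrib[symmetric])
  also have "\<dots> = real (card \<G>) * ((1 / real b) * (4 * L * mean_gap k + 2 * reference_error k))"
    using card_\<G>_pos batch_pos by (simp add: reference_error_eq[OF sq] field_simps)
  finally show ?thesis
    using card_\<G>_pos by (simp add: field_simps)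
qed

text \<open>Compare both messages with the common mean \<open>\<nabla>f (x k)\<close>. The factor \<open>2\<close> is the one of
  \<open>norm_add_sq_le\<close>.\<close>

lemma message_pair_distance:
  assumes k: "k < K" and sq: "iterates_square_integrable k" and il: "i \<in> \<G>" "l \<in> \<G>"
  shows "expectation (\<lambda>\<omega>. (norm (g i k \<omega> - g l k \<omega>))\<^sup>2) \<le> 2 * message_error i k + 2 * message_error l k"
proof -
  let ?D = "\<lambda>i \<omega>. g i k \<omega> - gradient (average m f) (x k \<omega>)"
  have D: "square_integrable M (?D i)" if "i \<in> \<G>" for i
    by (intro square_integrable_diff square_integrable_message square_integrable_gradient_objective
        iterates_square_integrableD k sq that)
  have "expectation (\<lambda>\<omega>. (norm (g i k \<omega> - g l k \<omega>))\<^sup>2)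
      \<le> expectation (\<lambda>\<omega>. 2 * (norm (?D i \<omega>))\<^sup>2 + 2 * (norm (?D l \<omega>))\<^sup>2)"
  proof (rule integral_mono)
    show "integrable M (\<lambda>\<omega>. (norm (g i k \<omega> - g l k \<omega>))\<^sup>2)"
      by (intro square_integrable_norm_sq square_integrable_diff square_integrable_message k sq il)
    show "integrable M (\<lambda>\<omega>. 2 * (norm (?D i \<omega>))\<^sup>2 + 2 * (norm (?D l \<omega>))\<^sup>2)"
      using square_integrable_norm_sq[OF D] il by simp
    show "(norm (g i k \<omega> - g l k \<omega>))\<^sup>2 \<le> 2 * (norm (?D i \<omega>))\<^sup>2 + 2 * (norm (?D l \<omega>))\<^sup>2" for \<omega>
      using norm_add_sq_le[of "?D i \<omega>" "- ?D l \<omega>"] by (simp add: norm_minus_commute)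
  qed
  also have "\<dots> = 2 * message_error i k + 2 * message_error l k"
    using square_integrable_norm_sq[OF D] il by (simp add: message_error_def)
  finally show ?thesis .
qed

text \<open>Each of the \<open>card \<G> * (card \<G> - 1)\<close> pairs of distinct workers costs twice the errors of
  both, and the diagonal contributes nothing; this is why the normalization leaves a multiple of the mean.\<close>

lemma message_spread:
  assumes k: "k < K" and sq: "iterates_square_integrable k"
  shows "1 / (real (card \<G>) * (real (card \<G>) - 1)) *
      (\<Sum>i\<in>\<G>. \<Sum>l\<in>\<G>. expectation (\<lambda>\<omega>. (norm (g i k \<omega> - g l k \<omega>))\<^sup>2))
    \<le> 4 * ((1 / real (card \<G>)) * (\<Sum>i\<in>\<G>. message_error i k))"
proof -
  let ?V = "\<Sum>i\<in>\<G>. message_error i k"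
  have "(\<Sum>l\<in>\<G>. expectation (\<lambda>\<omega>. (norm (g i k \<omega> - g l k \<omega>))\<^sup>2))
      \<le> 2 * (real (card \<G>) - 2) * message_error i k + 2 * ?V" if i: "i \<in> \<G>" for i
  proof -
    have "(\<Sum>l\<in>\<G>. expectation (\<lambda>\<omega>. (norm (g i k \<omega> - g l k \<omega>))\<^sup>2))
        = (\<Sum>l\<in>\<G> - {i}. expectation (\<lambda>\<omega>. (norm (g i k \<omega> - g l k \<omega>))\<^sup>2))"
      by (subst sum.remove[OF finite_\<G> i]) simp
    \<comment> \<open>Dropping the diagonal is needed to arrive at \<open>card \<G> - 1\<close>.\<close>
    also have "\<dots> \<le> (\<Sum>l\<in>\<G> - {i}. 2 * message_error i k + 2 * message_error l k)"
      by (intro sum_mono message_pair_distance k sq i) auto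
    also have "\<dots> = (\<Sum>l\<in>\<G>. 2 * message_error i k + 2 * message_error l k) - 4 * message_error i k"
      by (subst sum.remove[OF finite_\<G> i]) simp
    also have "\<dots> = 2 * (real (card \<G>) - 2) * message_error i k + 2 * ?V"
      by (simp add: sum.distrib sum_distrib_left algebra_simps)
    finally show ?thesis .
  qed
  then have "(\<Sum>i\<in>\<G>. \<Sum>l\<in>\<G>. expectation (\<lambda>\<omega>. (norm (g i k \<omega> - g l k \<omega>))\<^sup>2))
      \<le> (\<Sum>i\<in>\<G>. 2 * (real (card \<G>) - 2) * message_error i k + 2 * ?V)"
    by (rule sum_mono)
  also have "\<dots> = 4 * (real (card \<G>) - 1) * ?V"
    unfolding sum.distrib sum_distrib_left[symmetric] by (simp add: algebra_simps)
  finally have "1 / (real (card \<G>) * (real (card \<G>) - 1)) *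
      (\<Sum>i\<in>\<G>. \<Sum>l\<in>\<G>. expectation (\<lambda>\<omega>. (norm (g i k \<omega> - g l k \<omega>))\<^sup>2))
    \<le> 1 / (real (card \<G>) * (real (card \<G>) - 1)) * (4 * (real (card \<G>) - 1) * ?V)"
    using \<G>(2) by (intro mult_left_mono) auto
  also have "\<dots> = 4 * ((1 / real (card \<G>)) * ?V)"
    using \<G>(2) by (simp add: field_simps)
  finally show ?thesis .
qed

text \<open>Here the batchsize is used: the factor \<open>c * \<delta>\<close> of the aggregator is at most
  \<open>b * \<gamma> * \<mu>\<close>, and \<open>b\<close> cancels against the variance of the minibatch.\<close>

lemma aggregation_error_sq:
  assumes k: "k < K" and sq: "iterates_square_integrable k"
  shows "expectation (\<lambda>\<omega>. (norm (aggregation_error k \<omega>))\<^sup>2)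
    \<le> \<gamma> * \<mu> * (16 * L * mean_gap k + 8 * reference_error k)"
proof -
  let ?R = "4 * L * mean_gap k + 2 * reference_error k"
  have R: "0 \<le> ?R"
    using L mean_gap_nonneg reference_error_nonneg by simp
  have "expectation (\<lambda>\<omega>. (norm (aggregation_error k \<omega>))\<^sup>2) \<le> c * \<delta> *
      (1 / (real (card \<G>) * (real (card \<G>) - 1)) *
      (\<Sum>i\<in>\<G>. \<Sum>l\<in>\<G>. expectation (\<lambda>\<omega>. (norm (g i k \<omega> - g l k \<omega>))\<^sup>2)))"
    by (rule aggregation_error_bound(2)[OF k square_integrable_message[OF k sq]])
  also have "\<dots> \<le> c * \<delta> * (4 * ((1 / real b) * ?R))"
    using order_trans[OF message_spread[OF k sq] mult_left_mono[OF mean_message_error[OF k sq]]] c \<delta>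
    by (intro mult_left_mono) auto
  also have "\<dots> \<le> (real b * (\<gamma> * \<mu>)) * (4 * ((1 / real b) * ?R))"
    using b(2) R batch_pos by (intro mult_right_mono) auto
  also have "\<dots> = \<gamma> * \<mu> * (16 * L * mean_gap k + 8 * reference_error k)"
    using batch_pos by (simp add: field_simps)
  finally show ?thesis .
qed

lemma square_integrable_mean_message:
  assumes "k < K" "iterates_square_integrable k"
  shows "square_integrable M (mean_message k)"
  unfolding mean_message_def[abs_def]
  by (intro square_integrable_scaleR square_integrable_sum square_integrable_message assms)

lemma mean_message_unbiased:
  assumes k: "k < K" and sq: "iterates_square_integrable k"
    and Y: "Y \<in> borel_measurable (past k)" "square_integrable M Y"
  shows "expectation (\<lambda>\<omega>. Y \<omega> \<bullet> mean_message k \<omega>)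
    = expectation (\<lambda>\<omega>. Y \<omega> \<bullet> gradient (average m f) (x k \<omega>))"
proof -
  have "expectation (\<lambda>\<omega>. Y \<omega> \<bullet> mean_message k \<omega>)
      = (1 / real (card \<G>)) * (\<Sum>i\<in>\<G>. expectation (\<lambda>\<omega>. Y \<omega> \<bullet> g i k \<omega>))"
    using integrable_inner[OF Y(2) square_integrable_message[OF k sq]]
    by (simp add: mean_message_def inner_sum_right Bochner_Integration.integral_sum)
  also have "\<dots> = (1 / real (card \<G>)) *
      (\<Sum>i\<in>\<G>. expectation (\<lambda>\<omega>. Y \<omega> \<bullet> gradient (average m f) (x k \<omega>)))"
    using message_unbiased[OF k sq _ Y] by simp
  finally show ?thesis
    using card_\<G>_pos by simp
qed

text \<open>Bias-variance decomposition: unbiasedness removes the cross term, the bias part is the squared full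
  gradient, and the variance part is bounded by the mean of the individual variances with
  \<open>1 / b \<le> 1\<close>.\<close>

lemma mean_message_sq:
  assumes k: "k < K" and sq: "iterates_square_integrable k"
  shows "expectation (\<lambda>\<omega>. (norm (mean_message k \<omega>))\<^sup>2) \<le> 6 * L * mean_gap k + 2 * reference_error k"
proof -
  let ?q = "\<lambda>\<omega>. gradient (average m f) (x k \<omega>)"
  let ?D = "\<lambda>i \<omega>. g i k \<omega> - ?q \<omega>"
  have q: "square_integrable M ?q"
    by (intro square_integrable_gradient_objective iterates_square_integrableD sq)
  have mm: "square_integrable M (mean_message k)"
    by (rule square_integrable_mean_message[OF k sq])
  have D: "square_integrable M (?D i)" if "i \<in> \<G>" for i
    by (intro square_integrable_diff square_integrable_message q k sq that)
  have past_q: "?q \<in> borel_measurable (past k)"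
    using measurable_compose[OF x_measurable gradient_objective_measurable] k by simp
  note int = square_integrable_norm_sq[OF q] integrable_inner[OF q mm]
    square_integrable_norm_sq[OF square_integrable_diff[OF mm q]]
  have "expectation (\<lambda>\<omega>. (norm (mean_message k \<omega>))\<^sup>2)
      = expectation (\<lambda>\<omega>. 2 * (?q \<omega> \<bullet> mean_message k \<omega>) - (norm (?q \<omega>))\<^sup>2
          + (norm (mean_message k \<omega> - ?q \<omega>))\<^sup>2)"
    by (intro Bochner_Integration.integral_cong refl)
      (simp add: power2_norm_eq_inner inner_simps inner_commute)
  also have "\<dots> = 2 * expectation (\<lambda>\<omega>. ?q \<omega> \<bullet> mean_message k \<omega>) - expectation (\<lambda>\<omega>. (norm (?q \<omega>))\<^sup>2)
      + expectation (\<lambda>\<omega>. (norm (mean_message k \<omega> - ?q \<omega>))\<^sup>2)"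
    using int by simp
  also have "expectation (\<lambda>\<omega>. ?q \<omega> \<bullet> mean_message k \<omega>) = expectation (\<lambda>\<omega>. (norm (?q \<omega>))\<^sup>2)"
    using mean_message_unbiased[OF k sq past_q q] by (simp add: power2_norm_eq_inner)
  finally have split: "expectation (\<lambda>\<omega>. (norm (mean_message k \<omega>))\<^sup>2)
      = expectation (\<lambda>\<omega>. (norm (?q \<omega>))\<^sup>2)
        + expectation (\<lambda>\<omega>. (norm (mean_message k \<omega> - ?q \<omega>))\<^sup>2)" by simp
  have "expectation (\<lambda>\<omega>. (norm (?q \<omega>))\<^sup>2) \<le> expectation (\<lambda>\<omega>. 2 * L * gap (x k \<omega>))"
    using integrable_gap[OF iterates_square_integrableD(1)[OF sq]] int(1)
    by (intro integral_mono gradient_objective_sq_le_gap) auto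
  then have first: "expectation (\<lambda>\<omega>. (norm (?q \<omega>))\<^sup>2) \<le> 2 * L * mean_gap k"
    by (simp add: mean_gap_def)
  have "expectation (\<lambda>\<omega>. (norm (mean_message k \<omega> - ?q \<omega>))\<^sup>2)
      \<le> expectation (\<lambda>\<omega>. (1 / real (card \<G>)) * (\<Sum>i\<in>\<G>. (norm (?D i \<omega>))\<^sup>2))"
  proof (rule integral_mono[OF int(3)])
    show "integrable M (\<lambda>\<omega>. (1 / real (card \<G>)) * (\<Sum>i\<in>\<G>. (norm (?D i \<omega>))\<^sup>2))"
      by (intro integrable_mult_right Bochner_Integration.integrable_sum square_integrable_norm_sq D)
    fix \<omega>
    have "mean_message k \<omega> - ?q \<omega> = (1 / real (card \<G>)) *\<^sub>R (\<Sum>i\<in>\<G>. ?D i \<omega>)"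
      using card_\<G>_pos
      by (simp add: mean_message_def sum_subtractf scaleR_diff_right sum_constant_scaleR)
    then show "(norm (mean_message k \<omega> - ?q \<omega>))\<^sup>2 \<le> (1 / real (card \<G>)) * (\<Sum>i\<in>\<G>. (norm (?D i \<omega>))\<^sup>2)"
      using norm_mean_sq_le[of \<G> "\<lambda>i. ?D i \<omega>"] finite_\<G> card_\<G>_pos by (metis card.empty of_nat_0 less_irrefl)
  qed
  also have "\<dots> = (1 / real (card \<G>)) * (\<Sum>i\<in>\<G>. message_error i k)"
    using square_integrable_norm_sq[OF D] 
    by (simp add: message_error_def Bochner_Integration.integral_sum)
  also have "\<dots> \<le> (1 / real b) * (4 * L * mean_gap k + 2 * reference_error k)"
    by (rule mean_message_error[OF k sq])
  also have "\<dots> \<le> 1 * (4 * L * mean_gap k + 2 * reference_error k)"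
    using L mean_gap_nonneg reference_error_nonneg b(1) by (intro mult_right_mono) auto
  finally show ?thesis
    using split first by simp
qed

lemma iterate_Suc:
  assumes "k < K" "\<omega> \<in> space M"
  shows "x (Suc k) \<omega> = x k \<omega> - \<gamma> *\<^sub>R (mean_message k \<omega> + aggregation_error k \<omega>)"
  using x_step[OF assms] by (simp add: aggregation_error_def messages_def)

lemma square_integrable_x_Suc:
  assumes k: "k < K" and sq: "iterates_square_integrable k"
  shows "square_integrable M (x (Suc k))"
proof -
  have "square_integrable M (\<lambda>\<omega>. x k \<omega> - \<gamma> *\<^sub>R (mean_message k \<omega> + aggregation_error k \<omega>))"
    by (intro square_integrable_diff square_integrable_scaleR square_integrable_add
        iterates_square_integrableD square_integrable_mean_message
        aggregation_error_bound(1) square_integrable_message k sq)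
  then show ?thesis
    by (rule square_integrable_cong_space[THEN iffD2, rotated]) (rule iterate_Suc[OF k])
qed

text \<open>The integrated form of \<open>inexact_step_sq_le\<close>. The constants are
  \<open>76 = 2 * 6 + 4 * 16\<close> and \<open>36 = 2 * 2 + 4 * 8\<close>: twice the bound on the mean message plus
  four times the bound on the aggregation error.\<close>

lemma distance_step:
  assumes k: "k < K" and sq: "iterates_square_integrable k"
  shows "expectation (\<lambda>\<omega>. (norm (x (Suc k) \<omega> - xs))\<^sup>2)
    \<le> (1 - \<gamma> * \<mu> / 2) * expectation (\<lambda>\<omega>. (norm (x k \<omega> - xs))\<^sup>2)
      - 2 * \<gamma> * mean_gap k + \<gamma>\<^sup>2 * (76 * L * mean_gap k + 36 * reference_error k)"
proof -
  let ?d = "\<lambda>\<omega>. x k \<omega> - xs"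
  let ?q = "\<lambda>\<omega>. gradient (average m f) (x k \<omega>)"
  have \<gamma>\<mu>: "\<gamma> * \<mu> \<le> 1"
    using \<gamma>(3) p(2) by simp
  have d: "square_integrable M ?d"
    by (intro square_integrable_diff square_integrable_const iterates_square_integrableD sq)
  have past_d: "?d \<in> borel_measurable (past k)"
    using x_measurable k by (intro borel_measurable_diff) auto
  have mm: "square_integrable M (mean_message k)"
    by (rule square_integrable_mean_message[OF k sq])
  have e: "square_integrable M (aggregation_error k)"
    by (intro aggregation_error_bound(1) square_integrable_message k sq)
  have q: "square_integrable M ?q"
    by (intro square_integrable_gradient_objective iterates_square_integrableD sq)
  note int = square_integrable_norm_sq[OF d] integrable_inner[OF d mm] square_integrable_norm_sq[OF mm]
    square_integrable_norm_sq[OF e]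
  have "expectation (\<lambda>\<omega>. (norm (x (Suc k) \<omega> - xs))\<^sup>2) \<le> expectation (\<lambda>\<omega>.
      (1 + \<gamma> * \<mu> / 2) * (norm (?d \<omega>))\<^sup>2 - 2 * \<gamma> * (?d \<omega> \<bullet> mean_message k \<omega>)
      + 2 * \<gamma>\<^sup>2 * (norm (mean_message k \<omega>))\<^sup>2 + 4 * \<gamma> / \<mu> * (norm (aggregation_error k \<omega>))\<^sup>2)"
  proof (rule integral_mono)
    show "integrable M (\<lambda>\<omega>. (norm (x (Suc k) \<omega> - xs))\<^sup>2)"
      by (intro square_integrable_norm_sq square_integrable_diff square_integrable_const
          square_integrable_x_Suc k sq)
    show "integrable M (\<lambda>\<omega>.
      (1 + \<gamma> * \<mu> / 2) * (norm (?d \<omega>))\<^sup>2 - 2 * \<gamma> * (?d \<omega> \<bullet> mean_message k \<omega>)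
      + 2 * \<gamma>\<^sup>2 * (norm (mean_message k \<omega>))\<^sup>2 + 4 * \<gamma> / \<mu> * (norm (aggregation_error k \<omega>))\<^sup>2)"
      by (intro Bochner_Integration.integrable_add Bochner_Integration.integrable_diff
          integrable_mult_right int)
    fix \<omega> assume "\<omega> \<in> space M"
    then have "x (Suc k) \<omega> - xs = ?d \<omega> - \<gamma> *\<^sub>R (mean_message k \<omega> + aggregation_error k \<omega>)"
      using iterate_Suc[OF k] by simp
    then show "(norm (x (Suc k) \<omega> - xs))\<^sup>2
      \<le> (1 + \<gamma> * \<mu> / 2) * (norm (?d \<omega>))\<^sup>2 - 2 * \<gamma> * (?d \<omega> \<bullet> mean_message k \<omega>)
      + 2 * \<gamma>\<^sup>2 * (norm (mean_message k \<omega>))\<^sup>2 + 4 * \<gamma> / \<mu> * (norm (aggregation_error k \<omega>))\<^sup>2"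
      using inexact_step_sq_le[OF \<gamma>(1) \<mu> \<gamma>\<mu>] by metis
  qed
  also have "\<dots> = (1 + \<gamma> * \<mu> / 2) * expectation (\<lambda>\<omega>. (norm (?d \<omega>))\<^sup>2)
      - 2 * \<gamma> * expectation (\<lambda>\<omega>. ?d \<omega> \<bullet> mean_message k \<omega>)
      + 2 * \<gamma>\<^sup>2 * expectation (\<lambda>\<omega>. (norm (mean_message k \<omega>))\<^sup>2)
      + 4 * \<gamma> / \<mu> * expectation (\<lambda>\<omega>. (norm (aggregation_error k \<omega>))\<^sup>2)"
    using int by simp
  finally have step: "expectation (\<lambda>\<omega>. (norm (x (Suc k) \<omega> - xs))\<^sup>2)
      \<le> (1 + \<gamma> * \<mu> / 2) * expectation (\<lambda>\<omega>. (norm (?d \<omega>))\<^sup>2)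
      - 2 * \<gamma> * expectation (\<lambda>\<omega>. ?d \<omega> \<bullet> mean_message k \<omega>)
      + 2 * \<gamma>\<^sup>2 * expectation (\<lambda>\<omega>. (norm (mean_message k \<omega>))\<^sup>2)
      + 4 * \<gamma> / \<mu> * expectation (\<lambda>\<omega>. (norm (aggregation_error k \<omega>))\<^sup>2)" .
  have "expectation (\<lambda>\<omega>. gap (x k \<omega>) + \<mu> / 2 * (norm (?d \<omega>))\<^sup>2) \<le> expectation (\<lambda>\<omega>. ?q \<omega> \<bullet> ?d \<omega>)"
    using integrable_gap[OF iterates_square_integrableD(1)[OF sq]] int(1) integrable_inner[OF q d]
    by (intro integral_mono gradient_objective_inner_ge) auto
  also have "expectation (\<lambda>\<omega>. gap (x k \<omega>) + \<mu> / 2 * (norm (?d \<omega>))\<^sup>2)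
      = mean_gap k + \<mu> / 2 * expectation (\<lambda>\<omega>. (norm (?d \<omega>))\<^sup>2)"
    using integrable_gap[OF iterates_square_integrableD(1)[OF sq]] int(1) by (simp add: mean_gap_def)
  also have "expectation (\<lambda>\<omega>. ?q \<omega> \<bullet> ?d \<omega>) = expectation (\<lambda>\<omega>. ?d \<omega> \<bullet> mean_message k \<omega>)"
    using mean_message_unbiased[OF k sq past_d d] by (simp add: inner_commute)
  finally have "2 * \<gamma> * (mean_gap k + \<mu> / 2 * expectation (\<lambda>\<omega>. (norm (?d \<omega>))\<^sup>2))
      \<le> 2 * \<gamma> * expectation (\<lambda>\<omega>. ?d \<omega> \<bullet> mean_message k \<omega>)"
    using \<gamma>(1) by (intro mult_left_mono) auto
  moreover have "2 * \<gamma>\<^sup>2 * expectation (\<lambda>\<omega>. (norm (mean_message k \<omega>))\<^sup>2)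
      \<le> 2 * \<gamma>\<^sup>2 * (6 * L * mean_gap k + 2 * reference_error k)"
    by (intro mult_left_mono mean_message_sq k sq) auto
  moreover have "4 * \<gamma> / \<mu> * expectation (\<lambda>\<omega>. (norm (aggregation_error k \<omega>))\<^sup>2)
      \<le> 4 * \<gamma> / \<mu> * (\<gamma> * \<mu> * (16 * L * mean_gap k + 8 * reference_error k))"
    using \<gamma>(1) \<mu> by (intro mult_left_mono aggregation_error_sq k sq) auto
  moreover have "4 * \<gamma> / \<mu> * (\<gamma> * \<mu> * (16 * L * mean_gap k + 8 * reference_error k))
      = \<gamma>\<^sup>2 * (64 * L * mean_gap k + 32 * reference_error k)"
    using \<mu> by (simp add: power2_eq_square algebra_simps)
  ultimately show ?thesis
    using step by (simp add: algebra_simps)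
qed

lemma w_Suc_split:
  fixes F :: "'a \<Rightarrow> real"
  assumes "k < K" "i \<in> \<G>" "\<omega> \<in> space M"
  shows "F (w i (Suc k) \<omega>)
    = indicator (coin i k) \<omega> * F (x k \<omega>) + F (w i k \<omega>) - indicator (coin i k) \<omega> * F (w i k \<omega>)"
  using w_step[OF assms] by simp

text \<open>A reference point is replaced with conditional probability \<open>p\<close>, and both candidates
  \<open>x k\<close> and \<open>w i k\<close> are determined by the past.\<close>

lemma expectation_w_Suc:
  assumes k: "k < K" and i: "i \<in> \<G>" and F: "F \<in> borel_measurable borel"
    and int: "integrable M (\<lambda>\<omega>. F (x k \<omega>))" "integrable M (\<lambda>\<omega>. F (w i k \<omega>))"
  shows "integrable M (\<lambda>\<omega>. F (w i (Suc k) \<omega>))"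
    and "expectation (\<lambda>\<omega>. F (w i (Suc k) \<omega>))
      = p * expectation (\<lambda>\<omega>. F (x k \<omega>)) + (1 - p) * expectation (\<lambda>\<omega>. F (w i k \<omega>))"
proof -
  have k': "k \<le> K" using k by simp
  note ind = expectation_indicator_constant_cond_prob[OF past_subalgebra[OF k'] coin_given_past[OF k i]]
  note ind_x = ind[OF measurable_compose[OF x_measurable[OF k'] F] int(1)]
  note ind_w = ind[OF measurable_compose[OF w_measurable[OF k' i] F] int(2)]
  note split = w_Suc_split[OF k i, where F = F]
  have "integrable M (\<lambda>\<omega>. indicator (coin i k) \<omega> * F (x k \<omega>) + F (w i k \<omega>)
      - indicator (coin i k) \<omega> * F (w i k \<omega>))"
    by (intro Bochner_Integration.integrable_add Bochner_Integration.integrable_diff ind_x ind_w int)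
  then show "integrable M (\<lambda>\<omega>. F (w i (Suc k) \<omega>))"
    by (rule Bochner_Integration.integrable_cong[THEN iffD2, OF refl, rotated]) (rule split)
  have "expectation (\<lambda>\<omega>. F (w i (Suc k) \<omega>)) = expectation (\<lambda>\<omega>.
      indicator (coin i k) \<omega> * F (x k \<omega>) + F (w i k \<omega>) - indicator (coin i k) \<omega> * F (w i k \<omega>))"
    by (intro Bochner_Integration.integral_cong refl split)
  also have "\<dots> = expectation (\<lambda>\<omega>. indicator (coin i k) \<omega> * F (x k \<omega>)) + expectation (\<lambda>\<omega>. F (w i k \<omega>))
      - expectation (\<lambda>\<omega>. indicator (coin i k) \<omega> * F (w i k \<omega>))"
    using ind_x(1) ind_w(1) int
    by (simp only: Bochner_Integration.integral_diff Bochner_Integration.integral_add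
        Bochner_Integration.integrable_add)
  finally show "expectation (\<lambda>\<omega>. F (w i (Suc k) \<omega>))
      = p * expectation (\<lambda>\<omega>. F (x k \<omega>)) + (1 - p) * expectation (\<lambda>\<omega>. F (w i k \<omega>))"
    unfolding ind_x(2) ind_w(2) by (simp add: algebra_simps)
qed

lemma iterates_square_integrable_Suc:
  assumes k: "k < K" and sq: "iterates_square_integrable k"
  shows "iterates_square_integrable (Suc k)"
  unfolding iterates_square_integrable_def
proof (intro conjI ballI square_integrable_x_Suc k sq)
  fix i assume i: "i \<in> \<G>"
  have "w i (Suc k) \<in> borel_measurable M"
    using past_le_M w_measurable[of "Suc k"] i k by (meson Suc_leI)
  moreover have "integrable M (\<lambda>\<omega>. (norm (w i (Suc k) \<omega>))\<^sup>2)"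
    by (rule expectation_w_Suc(1)[OF k i, where F = "\<lambda>y. (norm y)\<^sup>2"])
      (use iterates_square_integrableD[OF sq] i in \<open>auto intro: square_integrable_norm_sq\<close>)
  ultimately show "square_integrable M (w i (Suc k))"
    by (simp add: square_integrable_def)
qed

lemma all_iterates_square_integrable: "k \<le> K \<Longrightarrow> iterates_square_integrable k"
proof (induction k)
  case 0
  show ?case
    unfolding iterates_square_integrable_def
    using square_integrable_cong_space[of M "x 0" "\<lambda>_. x0"]
      square_integrable_cong_space[of M "w _ 0" "\<lambda>_. x0"]
      square_integrable_const[of x0] x_init w_init
    by blast
qed (use iterates_square_integrable_Suc in simp)

text \<open>With probability \<open>p\<close> the deviation at the reference point is that at \<open>x k\<close>, which is
  at most \<open>2 * L\<close> times the gap.\<close>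

lemma reference_step:
  assumes k: "k < K"
  shows "reference_error (Suc k) \<le> (1 - p) * reference_error k + p * (2 * L * mean_gap k)"
proof -
  have sq: "iterates_square_integrable k" and sq': "iterates_square_integrable (Suc k)"
    using all_iterates_square_integrable k by auto
  let ?G = "gradient_deviation"
  have meas: "?G \<in> borel_measurable borel"
    unfolding gradient_deviation_def[abs_def]
  proof (intro borel_measurable_times borel_measurable_const borel_measurable_sum)
    fix j assume "j \<in> {1..m}"
    note gradient_measurable[OF this, measurable]
    show "(\<lambda>y. (norm (gradient (f j) y - gradient (f j) xs))\<^sup>2) \<in> borel_measurable borel"
      by measurable
  qed
  note sx = iterates_square_integrableD(1)[OF sq]
  note sw = iterates_square_integrableD(2)[OF sq]
  have step: "expectation (\<lambda>\<omega>. ?G (w i (Suc k) \<omega>))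
      = p * expectation (\<lambda>\<omega>. ?G (x k \<omega>)) + (1 - p) * expectation (\<lambda>\<omega>. ?G (w i k \<omega>))"
    if i: "i \<in> \<G>" for i
    by (intro expectation_w_Suc(2) k i meas integrable_gradient_deviation sx sw)
  have "reference_error (Suc k) = (1 / real (card \<G>)) *
      (\<Sum>i\<in>\<G>. p * expectation (\<lambda>\<omega>. ?G (x k \<omega>)) + (1 - p) * expectation (\<lambda>\<omega>. ?G (w i k \<omega>)))"
    using step by (simp add: reference_error_eq[OF sq'])
  also have "\<dots> = p * expectation (\<lambda>\<omega>. ?G (x k \<omega>)) + (1 - p) * reference_error k"
    using card_\<G>_pos unfolding reference_error_eq[OF sq] sum.distrib sum_distrib_left[symmetric]
    by (simp add: field_simps)
  finally have eq: "reference_error (Suc k) = p * expectation (\<lambda>\<omega>. ?G (x k \<omega>)) + (1 - p) * reference_error k" .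
  have "expectation (\<lambda>\<omega>. ?G (x k \<omega>)) \<le> expectation (\<lambda>\<omega>. 2 * L * gap (x k \<omega>))"
    using integrable_gap[OF sx] integrable_gradient_deviation[OF sx] gradients_deviation_le_gap
    by (intro integral_mono) (auto simp: gradient_deviation_def)
  then have "expectation (\<lambda>\<omega>. ?G (x k \<omega>)) \<le> 2 * L * mean_gap k"
    by (simp add: mean_gap_def)
  from mult_left_mono[OF this, of p] show ?thesis
    using eq p(1) by simp
qed

definition mean_Psi :: "nat \<Rightarrow> real" where
  "mean_Psi k = expectation (\<lambda>\<omega>. (norm (x k \<omega> - xs))\<^sup>2) + 72 * \<gamma>\<^sup>2 / p * reference_error k"

text \<open>The weight \<open>72 * \<gamma>\<^sup>2 / p\<close> is chosen so that the term
  \<open>36 * \<gamma>\<^sup>2 * \<sigma>\<^sup>2\<close> of the distance recursion is half of \<open>p\<close>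
  times the weighted reference error.\<close>

lemma mean_Psi_step:
  assumes k: "k < K"
  shows "mean_Psi (Suc k) \<le> (1 - \<gamma> * \<mu> / 2) * mean_Psi k"
proof -
  let ?\<Gamma> = "mean_gap k" and ?s = "reference_error k"
  let ?D = "expectation (\<lambda>\<omega>. (norm (x k \<omega> - xs))\<^sup>2)"
  have sq: "iterates_square_integrable k"
    using all_iterates_square_integrable k by auto
  have "72 * \<gamma>\<^sup>2 / p * reference_error (Suc k)
      \<le> 72 * \<gamma>\<^sup>2 / p * ((1 - p) * ?s + p * (2 * L * ?\<Gamma>))"
    using p(1) by (intro mult_left_mono reference_step k) auto
  also have "\<dots> = 72 * \<gamma>\<^sup>2 / p * ((1 - p) * ?s) + \<gamma>\<^sup>2 * (144 * L * ?\<Gamma>)"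
    using p(1) by (simp add: field_simps)
  finally have "mean_Psi (Suc k) \<le> (1 - \<gamma> * \<mu> / 2) * ?D
      + (\<gamma>\<^sup>2 * (220 * L * ?\<Gamma>) - 2 * \<gamma> * ?\<Gamma>) + (72 * \<gamma>\<^sup>2 / p * ((1 - p) * ?s) + 36 * \<gamma>\<^sup>2 * ?s)"
    using distance_step[OF k sq] by (simp add: mean_Psi_def algebra_simps)
  moreover have "\<gamma>\<^sup>2 * (220 * L * ?\<Gamma>) - 2 * \<gamma> * ?\<Gamma> \<le> 0"
  proof -
    have "144 * (\<gamma> * L) \<le> 1"
      using \<gamma>(2) L by (simp add: field_simps)
    then have "220 * (\<gamma> * L) - 2 \<le> 0"
      by linarith
    then have "(220 * (\<gamma> * L) - 2) * (\<gamma> * ?\<Gamma>) \<le> 0"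
      using \<gamma>(1) mean_gap_nonneg by (intro mult_nonpos_nonneg mult_nonneg_nonneg) auto
    then show ?thesis
      by (simp add: power2_eq_square algebra_simps)
  qed
  moreover have "72 * \<gamma>\<^sup>2 / p * ((1 - p) * ?s) + 36 * \<gamma>\<^sup>2 * ?s
      \<le> (1 - \<gamma> * \<mu> / 2) * (72 * \<gamma>\<^sup>2 / p * ?s)"
  proof -
    have "72 * \<gamma>\<^sup>2 / p * ((1 - p) * ?s) + 36 * \<gamma>\<^sup>2 * ?s = (1 - p / 2) * (72 * \<gamma>\<^sup>2 / p * ?s)"
      using p(1) by (simp add: field_simps)
    also have "\<dots> \<le> (1 - \<gamma> * \<mu> / 2) * (72 * \<gamma>\<^sup>2 / p * ?s)"
      using \<gamma>(3) p(1) reference_error_nonneg by (intro mult_right_mono) auto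
    finally show ?thesis .
  qed
  moreover have "(1 - \<gamma> * \<mu> / 2) * mean_Psi k
      = (1 - \<gamma> * \<mu> / 2) * ?D + (1 - \<gamma> * \<mu> / 2) * (72 * \<gamma>\<^sup>2 / p * ?s)"
    unfolding mean_Psi_def by (rule distrib_left)
  ultimately show ?thesis by linarith
qed

lemma mean_Psi_bound: "k \<le> K \<Longrightarrow> mean_Psi k \<le> (1 - \<gamma> * \<mu> / 2) ^ k * mean_Psi 0"
proof (induction k)
  case (Suc k)
  have "0 \<le> 1 - \<gamma> * \<mu> / 2"
    using \<gamma>(3) p(2) by simp
  then have "(1 - \<gamma> * \<mu> / 2) * mean_Psi k \<le> (1 - \<gamma> * \<mu> / 2) * ((1 - \<gamma> * \<mu> / 2) ^ k * mean_Psi 0)"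
    using Suc by (intro mult_left_mono) auto
  with mean_Psi_step[of k] Suc.prems show ?case
    by simp
qed simp

lemma mean_Psi_0: "mean_Psi 0 = Psi \<G> m f \<gamma> p xs x0 (\<lambda>_. x0)"
proof -
  have "expectation (\<lambda>\<omega>. (norm (x 0 \<omega> - xs))\<^sup>2) = expectation (\<lambda>\<omega>. (norm (x0 - xs))\<^sup>2)"
    by (intro Bochner_Integration.integral_cong refl) (simp add: x_init)
  moreover have "reference_error 0 = expectation (\<lambda>\<omega>. sigma_sq \<G> m f xs (\<lambda>_. x0))"
    unfolding reference_error_def
    by (intro Bochner_Integration.integral_cong refl) (simp add: sigma_sq_def w_init)
  ultimately show ?thesis
    by (simp add: mean_Psi_def Psi_def prob_space)
qed

lemma Psi_integrable:
  assumes "k \<le> K"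
  shows "integrable M (\<lambda>\<omega>. Psi \<G> m f \<gamma> p xs (x k \<omega>) (\<lambda>i. w i k \<omega>))"
    and "expectation (\<lambda>\<omega>. Psi \<G> m f \<gamma> p xs (x k \<omega>) (\<lambda>i. w i k \<omega>)) = mean_Psi k"
proof -
  have sq: "iterates_square_integrable k"
    using all_iterates_square_integrable assms by auto
  have dist: "integrable M (\<lambda>\<omega>. (norm (x k \<omega> - xs))\<^sup>2)"
    by (intro square_integrable_norm_sq square_integrable_diff square_integrable_const
        iterates_square_integrableD sq)
  have ref: "integrable M (\<lambda>\<omega>. sigma_sq \<G> m f xs (\<lambda>i. w i k \<omega>))"
    unfolding sigma_sq_eq
    by (intro integrable_mult_right Bochner_Integration.integrable_sum integrable_gradient_deviation
        iterates_square_integrableD sq)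
  show "integrable M (\<lambda>\<omega>. Psi \<G> m f \<gamma> p xs (x k \<omega>) (\<lambda>i. w i k \<omega>))"
    unfolding Psi_def by (intro Bochner_Integration.integrable_add integrable_mult_right dist ref)
  show "expectation (\<lambda>\<omega>. Psi \<G> m f \<gamma> p xs (x k \<omega>) (\<lambda>i. w i k \<omega>)) = mean_Psi k"
    using dist ref unfolding Psi_def mean_Psi_def reference_error_def by simp
qed

end

section \<open>Linear convergence\<close>

theorem theorem2:
  fixes f :: "nat \<Rightarrow> 'a::euclidean_space \<Rightarrow> real"
    and M :: "'o measure" and S :: "'s measure"
    and n m b K :: nat and \<G> :: "nat set"
    and L \<mu> \<gamma> p \<delta> c :: real and xs x0 :: 'a
  assumes "m \<ge> 1" and "L > 0" and "\<mu> > 0"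
    and "\<forall>j\<in>{1..m}. convex_differentiable (f j)"
    and "\<forall>j\<in>{1..m}. smooth L (f j)"
    and "strongly_convex \<mu> (average m f)"
    and "\<forall>y. average m f xs \<le> average m f y"
    and "0 \<le> \<delta>" and "\<delta> < 1 / 2" and "c > 0"
    and "\<G> \<subseteq> {1..n}" and "card \<G> \<ge> 2" and "real (card \<G>) \<ge> (1 - \<delta>) * real n"
    and "0 < p" and "p \<le> 1"
    and "0 < \<gamma>" and "\<gamma> \<le> min (1 / (144 * L)) (p / \<mu>)"
    and "real b \<ge> max 1 (c * \<delta> / (\<gamma> * \<mu>))"
    and "agnostic_robust_aggregator n \<delta> c S A"
    and "br_lsvrg M n \<G> m f \<gamma> b p x0 S A K past sent J coin U x w g"
  shows "integrable M (\<lambda>\<omega>. Psi \<G> m f \<gamma> p xs (x K \<omega>) (\<lambda>i. w i K \<omega>)) \<and>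
         prob_space.expectation M (\<lambda>\<omega>. Psi \<G> m f \<gamma> p xs (x K \<omega>) (\<lambda>i. w i K \<omega>))
           \<le> (1 - \<gamma> * \<mu> / 2) ^ K * Psi \<G> m f \<gamma> p xs x0 (\<lambda>_. x0)"
proof -
  have ml: "\<gamma> * \<mu> \<le> p"
    using \<open>\<gamma> \<le> min (1 / (144 * L)) (p / \<mu>)\<close> \<open>\<mu> > 0\<close> by (simp add: field_simps)
  have batch: "c * \<delta> \<le> real b * (\<gamma> * \<mu>)" "b \<ge> 1"
    using \<open>real b \<ge> max 1 (c * \<delta> / (\<gamma> * \<mu>))\<close> \<open>0 < \<gamma>\<close> \<open>\<mu> > 0\<close> by (simp_all add: field_simps)
  have stepsize: "\<gamma> \<le> 1 / (144 * L)"
    using \<open>\<gamma> \<le> min (1 / (144 * L)) (p / \<mu>)\<close> by simp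
  note run = \<open>br_lsvrg M n \<G> m f \<gamma> b p x0 S A K past sent J coin U x w g\<close>
  interpret br_lsvrg_convex M n \<G> m f \<gamma> b p x0 S A K past sent J coin U x w g L \<mu> \<delta> c xs
    by (intro br_lsvrg_convex.intro br_lsvrg_convex_axioms.intro run)
      (fact ml batch stepsize assms | use assms(4,5,7) in blast)+
  show ?thesis
    using Psi_integrable[of K] mean_Psi_bound[of K] mean_Psi_0 by simp
qed

end
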